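(* Let $\mu$ be as in the context and suppose that for some $r_0\in[0,\infty)$ the partial super Poincaré inequality holds for $r>r_0$ with some function $\beta$. Then for every $\kappa\in(0,1/2]$ there is a constant $C_\kappa>0$ such that \[\forall A\text{ measurable},\quad \mu(A)\le\kappa\ \Longrightarrow\ \operatorname{cap}_\mu(A)\ge C_\kappa\,\mu(A),\] and the constants can be chosen so that $\liminf_{\kappa\to0}C_\kappa\ge 1/r_0$ (with $1/0=+\infty$; in particular $C_\kappa\to\infty$ as $\kappa\to0$ if the full super Poincaré inequality holds).
   Context: Setting: $V:\mathbb R^n\to\mathbb R$ smooth with $\int e^{-V}dx<\infty$, $\mu(dx)=Z^{-1}e^{-V(x)}dx$ a probability measure on $\mathbb R^n$; "admissible $f$" means $f\in L^2(\mu)$ locally Lipschitz with $\int|\nabla f|^2d\mu<\infty$. Partial super Poincaré inequality for $r>r_0$: for every $r>r_0$ there is $\beta(r)<\infty$ with $\int f^2d\mu\le r\int|\nabla f|^2d\mu+\beta(r)(\int|f|d\mu)^2$ for all admissible $f$ (full SPI: $r_0=0$). Capacity: for measurable $A$ with $\mu(A)\le1/2$, $\operatorname{cap}_\mu(A)=\inf\{\int|\nabla f|^2d\mu : f\text{ admissible},\ \mathbf 1_A\le f\le1,\ \mu(\{f\neq0\})\le1/2\}$. *)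

theory Defs
  imports "HOL-Analysis.Analysis" "HOL-Library.Liminf_Limsup"
begin

fun Ck :: "nat \<Rightarrow> (real ^ 'n \<Rightarrow> real) \<Rightarrow> bool" where
  "Ck 0 f = continuous_on UNIV f"
| "Ck (Suc k) f = ((\<forall>x. f differentiable (at x)) \<and> continuous_on UNIV f \<and>
      (\<forall>i. Ck k (\<lambda>x. frechet_derivative f (at x) (axis i 1))))"

definition smooth :: "(real ^ 'n \<Rightarrow> real) \<Rightarrow> bool" where
  "smooth f \<longleftrightarrow> (\<forall>k. Ck k f)"

definition Zc :: "(real ^ 'n \<Rightarrow> real) \<Rightarrow> real" where
  "Zc V = integral\<^sup>L lborel (\<lambda>x. exp (- V x))"

definition mu :: "(real ^ 'n \<Rightarrow> real) \<Rightarrow> (real ^ 'n) measure" where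
  "mu V = density lebesgue (\<lambda>x. ennreal (exp (- V x) / Zc V))"

text \<open>Gradient (defined where f is differentiable; locally Lipschitz f are differentiable a.e.).\<close>
definition grad :: "(real ^ 'n \<Rightarrow> real) \<Rightarrow> real ^ 'n \<Rightarrow> real ^ 'n" where
  "grad f x = (if f differentiable (at x)
               then (\<chi> i. frechet_derivative f (at x) (axis i 1)) else 0)"

definition locally_lipschitz :: "(real ^ 'n \<Rightarrow> real) \<Rightarrow> bool" where
  "locally_lipschitz f \<longleftrightarrow> (\<forall>x. \<exists>e>0. \<exists>L. L-lipschitz_on (ball x e) f)"

definition admissible :: "(real ^ 'n \<Rightarrow> real) \<Rightarrow> (real ^ 'n \<Rightarrow> real) \<Rightarrow> bool" where
  "admissible V f \<longleftrightarrow>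
     f \<in> borel_measurable (mu V) \<and> integrable (mu V) (\<lambda>x. (f x)\<^sup>2) \<and>
     locally_lipschitz f \<and> integrable (mu V) (\<lambda>x. (norm (grad f x))\<^sup>2)"

definition energy :: "(real ^ 'n \<Rightarrow> real) \<Rightarrow> (real ^ 'n \<Rightarrow> real) \<Rightarrow> real" where
  "energy V f = (\<integral>x. (norm (grad f x))\<^sup>2 \<partial>mu V)"

text \<open>Capacity, valued in ereal (infimum of the empty set = +infinity).\<close>
definition cap :: "(real ^ 'n \<Rightarrow> real) \<Rightarrow> (real ^ 'n) set \<Rightarrow> ereal" where
  "cap V A = (INF f \<in> {f. admissible V f \<and> (\<forall>x. indicator A x \<le> f x \<and> f x \<le> 1) \<and>
                           measure (mu V) {x. f x \<noteq> 0} \<le> 1/2}. ereal (energy V f))"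

definition partial_SPI :: "(real ^ 'n \<Rightarrow> real) \<Rightarrow> real \<Rightarrow> (real \<Rightarrow> real) \<Rightarrow> bool" where
  "partial_SPI V r0 \<beta> \<longleftrightarrow> (\<forall>r>r0. \<forall>f. admissible V f \<longrightarrow>
     (\<integral>x. (f x)\<^sup>2 \<partial>mu V) \<le> r * energy V f + \<beta> r * (\<integral>x. \<bar>f x\<bar> \<partial>mu V)\<^sup>2)"

end

(* Let f be a competitor for the capacity of A, so that 1_A <= f <= 1 and f vanishes on half of the
   space. For 0 < t < 1 the function g = (f - t)^+ / (1 - t) equals 1 on A, has energy at most
   E(f) / (1 - t)^2, and satisfies (int g)^2 <= mu(f > t) int g^2 <= t^-2 int f^2 int g^2. If int f^2
   is at most a small constant c, the last term of the super Poincare inequality for g is therefore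
   absorbed into the left-hand side, and mu(A) <= int g^2 is bounded by almost r E(f). If int f^2
   exceeds c, then f oscillates by a definite amount on a fixed large ball, where the density of mu
   lies between two positive constants; the oscillation is bounded by the L^1 norm of the gradient,
   so E(f) >= e(c) > 0 and E(f) >= M mu(A) as soon as mu(A) <= e(c) / M.

   That the gradient of a locally Lipschitz function controls the function rests on Rademacher's
   theorem. In dimension one it follows from the Vitali covering theorem applied to the Stieltjes
   measure of a monotone Lipschitz function. In general, partial derivatives exist almost everywhere
   by Fubini, and at almost every point they are locally almost constant along a set without holes,
   which upgrades them to a total derivative. *)

theory Submission
  imports Defs
begin

text \<open>\<open>grad\<close> is set to 0 wherever a function is not differentiable, so the energy
  alone would not notice a competitor that fails to be differentiable on a large set. Almost
  everywhere differentiability therefore enters three times: in the measurability of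
  \<open>grad\<close>, in the comparison of the gradients of f and of its truncation, and in the
  passage from difference quotients to gradients when the oscillation is estimated. The lower bound
  e(c) rests on two facts about the large ball: f vanishes on a part of mass at least 1/4, and its
  integral there is at least c/2. Since e(c) does not depend on A and mu(A) \<le> 1, it also yields
  a positive constant at kappa = 1/2. Near kappa = 0 a single family of constants has to serve every
  r > r_0 at once, which is why it is defined by suprema.\<close>

section \<open>Vitali coverings and comparison of measures\<close>

text \<open>The points of E only have to lie in the small balls, not at their centres, so that an
  interval with endpoint x qualifies. If the radius is less than e/2, a ball containing x stays
  within distance e of x and hence in \<open>U\<close>; Vitali's theorem is applied to such balls
  only.\<close>

lemma fine_cball_cover:
  fixes E U :: "'a::euclidean_space set" and P :: "'a \<Rightarrow> real \<Rightarrow> bool"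
  assumes "open U" "E \<subseteq> U"
    and fine: "\<And>x d. x \<in> E \<Longrightarrow> 0 < d \<Longrightarrow> \<exists>a r. 0 < r \<and> r < d \<and> x \<in> cball a r \<and> P a r"
  obtains C where "countable C" "disjoint_family_on (\<lambda>(a, r). cball a r) C"
    "\<And>a r. (a, r) \<in> C \<Longrightarrow> 0 < r \<and> P a r \<and> cball a r \<subseteq> U"
    "negligible (E - (\<Union>(a, r)\<in>C. cball a r))"
proof -
  define K where "K = {(a, r). 0 < r \<and> P a r \<and> cball a r \<subseteq> U}"
  have K: "\<exists>i. i \<in> K \<and> x \<in> cball (fst i) (snd i) \<and> snd i < d" if xE: "x \<in> E" "0 < d" for x d
  proof -
    obtain e where e: "e > 0" "ball x e \<subseteq> U"
      using \<open>open U\<close>[unfolded open_contains_ball] subsetD[OF \<open>E \<subseteq> U\<close> xE(1)] by meson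
    have "0 < min d (e/2)" using xE(2) e(1) by simp
    from fine[OF xE(1) this]
    obtain a r where ar: "0 < r" "r < min d (e/2)" "x \<in> cball a r" "P a r" by blast
    have "cball a r \<subseteq> ball x e"
    proof
      fix y assume "y \<in> cball a r"
      then have "dist x y \<le> dist a x + dist a y"
        by (metis dist_commute dist_triangle)
      also have "\<dots> \<le> r + r" using ar \<open>y \<in> _\<close> by (intro add_mono) auto
      also have "\<dots> < e" using ar by simp
      finally show "y \<in> ball x e" by simp
    qed
    then have "(a, r) \<in> K" using ar e by (auto simp: K_def)
    then show ?thesis using ar by (intro exI[of _ "(a, r)"]) auto
  qed
  have r: "0 < snd i" if "i \<in> K" for i using that by (auto simp: K_def)
  obtain C where C: "countable C" "C \<subseteq> K"
     "pairwise (\<lambda>i j. disjnt (cball (fst i) (snd i)) (cball (fst j) (snd j))) C"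
     "negligible (E - (\<Union>i \<in> C. cball (fst i) (snd i)))"
    by (rule Vitali_covering_theorem_cballs[of K snd E fst, OF r K])
  show thesis
  proof (rule that)
    show "countable C" by (rule C(1))
    show "disjoint_family_on (\<lambda>(a, r). cball a r) C"
      using C(3) by (simp add: disjoint_family_on_def pairwise_def disjnt_def case_prod_unfold)
    show "0 < r \<and> P a r \<and> cball a r \<subseteq> U" if "(a, r) \<in> C" for a r
      using subsetD[OF C(2) that] by (simp add: K_def)
    show "negligible (E - (\<Union>(a, r)\<in>C. cball a r))"
      using C(4) by (simp add: case_prod_unfold)
  qed
qed

text \<open>Countable additivity over the disjoint balls passes the ratio bound from single balls to
  their union. Dropping the boundary spheres, a null set, makes \<open>W\<close> open, as required
  for a second covering inside \<open>W\<close>.\<close>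

lemma Vitali_open_subset:
  fixes E U :: "'a::euclidean_space set" and p :: ennreal
  assumes N[measurable_cong]: "sets N = sets borel" and "open U" "E \<subseteq> U"
    and fine: "\<And>x d. x \<in> E \<Longrightarrow> 0 < d \<Longrightarrow> \<exists>a r. 0 < r \<and> r < d \<and> x \<in> cball a r \<and>
      emeasure N (cball a r) \<le> p * emeasure lborel (cball a r)"
  obtains W where "open W" "W \<subseteq> U" "negligible (E - W)" "emeasure N W \<le> p * emeasure lborel U"
proof -
  obtain C where C: "countable C" "disjoint_family_on (\<lambda>(a, r). cball a r) C"
    and Cp: "\<And>a r. (a, r) \<in> C \<Longrightarrow> 0 < r \<and>
      emeasure N (cball a r) \<le> p * emeasure lborel (cball a r) \<and> cball a r \<subseteq> U"
    and neg: "negligible (E - (\<Union>(a, r)\<in>C. cball a r))"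
    using fine_cball_cover[OF \<open>open U\<close> \<open>E \<subseteq> U\<close> fine] by blast
  define W where "W = (\<Union>(a, r)\<in>C. ball a r)"
  define X where "X = (\<Union>(a, r)\<in>C. cball a r)"
  have "negligible (\<Union>(a, r)\<in>C. sphere a r)"
    using C(1) by (auto intro!: negligible_countable_Union simp: negligible_sphere)
  then have "negligible ((E - X) \<union> (\<Union>(a, r)\<in>C. sphere a r))"
    using neg by (simp add: X_def negligible_Un)
  moreover have "E - W \<subseteq> (E - X) \<union> (\<Union>(a, r)\<in>C. sphere a r)"
    by (force simp: W_def X_def)
  ultimately have "negligible (E - W)" by (rule negligible_subset)
  moreover have "emeasure N W \<le> p * emeasure lborel U"
  proof -
    have Xb: "X \<in> sets borel" unfolding X_def using C(1)
      by (intro sets.countable_UN') auto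
    have "emeasure N W \<le> emeasure N X"
      using Xb by (intro emeasure_mono) (auto simp: W_def X_def N)
    also have "\<dots> = (\<integral>\<^sup>+i. emeasure N (case i of (a, r) \<Rightarrow> cball a r) \<partial>count_space C)"
      unfolding X_def by (rule emeasure_UN_countable) (use C in \<open>auto simp: N\<close>)
    also have "\<dots> \<le> (\<integral>\<^sup>+i. p * emeasure lborel (case i of (a, r) \<Rightarrow> cball a r) \<partial>count_space C)"
      by (rule nn_integral_mono) (use Cp in auto)
    also have "\<dots> = p * (\<integral>\<^sup>+i. emeasure lborel (case i of (a, r) \<Rightarrow> cball a r) \<partial>count_space C)"
      by (rule nn_integral_cmult) auto
    also have "\<dots> = p * emeasure lborel X"
      unfolding X_def by (subst emeasure_UN_countable) (use C in auto)
    also have "\<dots> \<le> p * emeasure lborel U"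
      using Cp \<open>open U\<close> by (intro mult_left_mono emeasure_mono) (auto simp: X_def)
    finally show ?thesis .
  qed
  moreover have "open W" by (auto simp: W_def)
  moreover have "W \<subseteq> U"
  proof -
    have "ball a r \<subseteq> U" if "(a, r) \<in> C" for a r
      using Cp[OF that] ball_subset_cball by (meson order_trans)
    then show ?thesis unfolding W_def by auto
  qed
  ultimately show thesis using that by simp
qed

text \<open>The disjoint balls cover almost all of \<open>E\<close>, and the ratio bounds add up
  inside \<open>U\<close>. With \<open>U\<close> taken from an upper bound on ratios, this plays one
  density bound against the other.\<close>

lemma Vitali_lower_bound:
  fixes E U :: "'a::euclidean_space set" and q :: ennreal
  assumes N[measurable_cong]: "sets N = sets borel" and "open U" "E \<subseteq> U" and E: "E \<in> sets borel"
    and fine: "\<And>x d. x \<in> E \<Longrightarrow> 0 < d \<Longrightarrow> \<exists>a r. 0 < r \<and> r < d \<and> x \<in> cball a r \<and>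
      q * emeasure lborel (cball a r) \<le> emeasure N (cball a r)"
  shows "q * emeasure lborel E \<le> emeasure N U"
proof -
  obtain C where C: "countable C" "disjoint_family_on (\<lambda>(a, r). cball a r) C"
    and Cp: "\<And>a r. (a, r) \<in> C \<Longrightarrow> 0 < r \<and>
      q * emeasure lborel (cball a r) \<le> emeasure N (cball a r) \<and> cball a r \<subseteq> U"
    and neg: "negligible (E - (\<Union>(a, r)\<in>C. cball a r))"
    using fine_cball_cover[OF \<open>open U\<close> \<open>E \<subseteq> U\<close> fine] by blast
  define X where "X = (\<Union>(a, r)\<in>C. cball a r)"
  have Xb[measurable]: "X \<in> sets borel" unfolding X_def using C(1)
    by (intro sets.countable_UN') auto
  have "emeasure lborel (E - X) = 0"
    using neg E Xb by (auto simp: X_def[symmetric] negligible_iff_null_sets null_sets_completion_iff null_sets_def)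
  moreover have "emeasure lborel E \<le> emeasure lborel ((E - X) \<union> X)"
    using E by (intro emeasure_mono) auto
  moreover have "\<dots> \<le> emeasure lborel (E - X) + emeasure lborel X"
    using E by (intro emeasure_subadditive) auto
  ultimately have "emeasure lborel E \<le> emeasure lborel X" by simp
  then have "q * emeasure lborel E \<le> q * emeasure lborel X" by (rule mult_left_mono) simp
  also have "\<dots> = q * (\<integral>\<^sup>+i. emeasure lborel (case i of (a, r) \<Rightarrow> cball a r) \<partial>count_space C)"
    unfolding X_def by (subst emeasure_UN_countable) (use C in auto)
  also have "\<dots> = (\<integral>\<^sup>+i. q * emeasure lborel (case i of (a, r) \<Rightarrow> cball a r) \<partial>count_space C)"
    by (rule nn_integral_cmult[symmetric]) auto
  also have "\<dots> \<le> (\<integral>\<^sup>+i. emeasure N (case i of (a, r) \<Rightarrow> cball a r) \<partial>count_space C)"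
    by (rule nn_integral_mono) (use Cp in auto)
  also have "\<dots> = emeasure N X"
    unfolding X_def by (rule emeasure_UN_countable[symmetric]) (use C in \<open>auto simp: N\<close>)
  also have "\<dots> \<le> emeasure N U"
    using Cp \<open>open U\<close> by (intro emeasure_mono) (auto simp: X_def N)
  finally show ?thesis .
qed

text \<open>By outer regularity the measure of \<open>U\<close> can be brought arbitrarily close to
  the measure s of \<open>E\<close>, so s \<le> c s + e for every e > 0. Boundedness makes s finite,
  and c < 1 forces s = 0.\<close>

lemma emeasure_0_of_outer_contraction:
  fixes E :: "'a::euclidean_space set" and c :: real
  assumes E: "E \<in> sets borel" "bounded E" and c: "0 \<le> c" "c < 1"
    and le: "\<And>U. open U \<Longrightarrow> E \<subseteq> U \<Longrightarrow> emeasure lborel E \<le> ennreal c * emeasure lborel U"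
  shows "emeasure lborel E = 0"
proof -
  have fin: "emeasure lborel E < \<infinity>" using E(2) by (rule emeasure_bounded_finite)
  define s where "s = measure lborel E"
  have s: "emeasure lborel E = ennreal s" "0 \<le> s"
    using fin by (auto simp: s_def emeasure_eq_ennreal_measure)
  have "s \<le> c * s + e" if e: "e > 0" for e
  proof -
    obtain U where U: "open U" "E \<subseteq> U" "emeasure lborel (U - E) < ennreal e"
      using outer_regular_lborel[OF E(1) e] by metis
    have "emeasure lborel U = emeasure lborel (E \<union> (U - E))" using U by (simp add: Un_absorb1)
    also have "\<dots> \<le> emeasure lborel E + emeasure lborel (U - E)"
      using E U(1) by (intro emeasure_subadditive) auto
    also have "\<dots> \<le> ennreal s + ennreal e" using U s by (intro add_mono) auto
    finally have "ennreal s \<le> ennreal c * (ennreal s + ennreal e)"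
      using le[OF U(1,2)] s by (metis (no_types, lifting) mult_left_mono order_trans zero_le)
    also have "\<dots> = ennreal (c * (s + e))"
      using s c e by (simp add: ennreal_mult flip: ennreal_plus)
    finally have "s \<le> c * (s + e)" using s c e by (simp add: ennreal_le_iff)
    also have "\<dots> \<le> c * s + e" using c e by (simp add: distrib_left mult_left_le_one_le)
    finally show ?thesis .
  qed
  then have "s \<le> c * s" by (rule field_le_epsilon)
  then have "s * (1 - c) \<le> 0" by (simp add: algebra_simps)
  then have "s \<le> 0" using c by (simp add: mult_le_0_iff)
  then show ?thesis using s by simp
qed

text \<open>It suffices to test the radii 1 / (n + 1). For fixed n the union over h is uncountable
  but open, so the set is a G-delta.\<close>

lemma sets_frequently_at_0:
  fixes P :: "'a::topological_space \<Rightarrow> real \<Rightarrow> bool"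
  assumes "\<And>h. open {x. P x h}"
  shows "{x. \<exists>\<^sub>F h in at 0. P x h} \<in> sets borel"
proof -
  have "{x. \<exists>\<^sub>F h in at 0. P x h} = (\<Inter>n. \<Union>h\<in>{h. h \<noteq> 0 \<and> \<bar>h\<bar> < 1 / real (Suc n)}. {x. P x h})"
    (is "?L = ?R")
  proof
    show "?L \<subseteq> ?R" by (fastforce simp: frequently_at)
    show "?R \<subseteq> ?L"
    proof
      fix x assume x: "x \<in> ?R"
      have "\<exists>h. h \<noteq> 0 \<and> dist h 0 < d \<and> P x h" if "d > 0" for d :: real
      proof -
        obtain n where n: "1 / real (Suc n) < d"
          using \<open>d > 0\<close> by (metis nat_approx_posE)
        then show ?thesis using x by (force dest: spec[of _ n])
      qed
      then show "x \<in> ?L" by (auto simp: frequently_at)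
    qed
  qed
  moreover have "open (\<Union>h\<in>{h. h \<noteq> 0 \<and> \<bar>h\<bar> < 1 / real (Suc n)}. {x. P x h})" for n
    using assms by auto
  ultimately show ?thesis by auto
qed

section \<open>Differentiability of Lipschitz functions on the line\<close>

definition slope :: "(real \<Rightarrow> real) \<Rightarrow> real \<Rightarrow> real \<Rightarrow> real" where
  "slope g x h = (g (x + h) - g x) / h"

lemma open_slope:
  assumes "continuous_on UNIV g"
  shows "open {x. slope g x h < p}" "open {x. q < slope g x h}"
proof -
  have c: "continuous_on UNIV (\<lambda>x. slope g x h)"
    unfolding slope_def divide_inverse
    by (intro continuous_intros continuous_on_compose2[OF assms]) auto
  show "open {x. slope g x h < p}" "open {x. q < slope g x h}"
    using c by (auto intro!: open_Collect_less continuous_intros)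
qed

text \<open>Serves to test two-sided difference quotients on Vitali balls: both signs of h are
  covered.\<close>

lemma interval_cball_between:
  fixes x h :: real
  defines "a \<equiv> x + h / 2" and "r \<equiv> \<bar>h\<bar> / 2"
  shows "cball a r = {min x (x + h)..max x (x + h)}" "x \<in> cball a r"
  unfolding a_def r_def by (auto simp: cball_eq_atLeastAtMost dist_real_def min_def max_def abs_if field_simps)

text \<open>The Stieltjes measure of a closed interval is the increment of \<open>g\<close>,
  continuity excluding an atom at the left endpoint. Bounds on slopes thus become bounds on ratios
  of measures.\<close>

lemma emeasure_interval_measure_slope:
  assumes "mono g" "continuous_on UNIV g" "h \<noteq> 0"
  shows "emeasure (interval_measure g) (cball (x + h / 2) (\<bar>h\<bar> / 2))
       = ennreal (slope g x h) * emeasure lborel (cball (x + h / 2) (\<bar>h\<bar> / 2))" (is "?L = ?R")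
proof -
  have "?L = ennreal (g (max x (x + h)) - g (min x (x + h)))"
    unfolding interval_cball_between using assms
    by (intro emeasure_interval_measure_Icc) (auto dest: monoD)
  also have "g (max x (x + h)) - g (min x (x + h)) = slope g x h * \<bar>h\<bar>"
    using assms(3) by (auto simp: slope_def max_def min_def abs_if field_simps)
  also have "ennreal \<dots> = ennreal (slope g x h) * ennreal \<bar>h\<bar>"
    by (rule ennreal_mult'') simp
  also have "ennreal \<bar>h\<bar> = emeasure lborel (cball (x + h / 2) (\<bar>h\<bar> / 2))"
    unfolding interval_cball_between by (subst emeasure_lborel_Icc) (auto simp: max_def min_def)
  finally show ?thesis .
qed

text \<open>Let \<open>U\<close> be open around a bounded part of the set. Slopes below p yield an
  open \<open>W\<close> inside \<open>U\<close> that covers almost all of this part and has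
  Stieltjes measure at most p times the length of \<open>U\<close>; slopes above q, sought inside
  \<open>W\<close>, bound q times the length of this part by the measure of \<open>W\<close>. Its
  length is thus contracted by the factor p / q < 1.\<close>

lemma null_oscillating_slope:
  fixes g :: "real \<Rightarrow> real"
  assumes g: "mono g" "continuous_on UNIV g" and pq: "0 \<le> p" "p < q"
  shows "{x. (\<exists>\<^sub>F h in at 0. slope g x h < p) \<and> (\<exists>\<^sub>F h in at 0. q < slope g x h)} \<in> null_sets lborel"
    (is "?E \<in> _")
proof -
  have E: "?E \<in> sets borel"
    unfolding Collect_conj_eq by (intro sets.Int sets_frequently_at_0 open_slope g(2))
  have 0: "emeasure lborel (?E \<inter> ball 0 R) = 0" for R
  proof (rule emeasure_0_of_outer_contraction[where c="p / q"])
    fix U assume U: "open U" "?E \<inter> ball 0 R \<subseteq> U"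
    have "\<exists>a r. 0 < r \<and> r < d \<and> x \<in> cball a r \<and>
        emeasure (interval_measure g) (cball a r) \<le> ennreal p * emeasure lborel (cball a r)"
      if x: "x \<in> ?E \<inter> ball 0 R" "0 < d" for x d
    proof -
      obtain h where "h \<noteq> 0" "\<bar>h\<bar> < d" "slope g x h < p"
        using x unfolding frequently_at by (auto simp: dist_real_def)
      then show ?thesis
        using interval_cball_between(2)[of x h]
        by (intro exI[of _ "x + h / 2"] exI[of _ "\<bar>h\<bar> / 2"])
           (auto simp: emeasure_interval_measure_slope[OF g] simp del: mem_cball intro!: mult_right_mono ennreal_leI)
    qed
    then obtain W where W: "open W" "W \<subseteq> U" "negligible (?E \<inter> ball 0 R - W)"
      "emeasure (interval_measure g) W \<le> ennreal p * emeasure lborel U"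
      using Vitali_open_subset[of "interval_measure g" U "?E \<inter> ball 0 R" "ennreal p"] U by auto
    have "ennreal q * emeasure lborel (?E \<inter> ball 0 R \<inter> W) \<le> emeasure (interval_measure g) W"
    proof (rule Vitali_lower_bound)
      fix x d :: real assume x: "x \<in> ?E \<inter> ball 0 R \<inter> W" "0 < d"
      then obtain h where "h \<noteq> 0" "\<bar>h\<bar> < d" "q < slope g x h"
        unfolding frequently_at by (auto simp: dist_real_def)
      then show "\<exists>a r. 0 < r \<and> r < d \<and> x \<in> cball a r \<and>
        ennreal q * emeasure lborel (cball a r) \<le> emeasure (interval_measure g) (cball a r)"
        using interval_cball_between(2)[of x h]
        by (intro exI[of _ "x + h / 2"] exI[of _ "\<bar>h\<bar> / 2"])
           (auto simp: emeasure_interval_measure_slope[OF g] simp del: mem_cball intro!: mult_right_mono ennreal_leI)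
    qed (use W E in auto)
    also note W(4)
    finally have *: "ennreal q * emeasure lborel (?E \<inter> ball 0 R \<inter> W) \<le> ennreal p * emeasure lborel U" .
    have "emeasure lborel (?E \<inter> ball 0 R - W) = 0"
      using W E by (auto simp: negligible_iff_null_sets null_sets_completion_iff null_sets_def)
    moreover have "emeasure lborel (?E \<inter> ball 0 R) =
       emeasure lborel (?E \<inter> ball 0 R \<inter> W) + emeasure lborel (?E \<inter> ball 0 R - W)"
      using E W by (subst plus_emeasure) (auto intro!: arg_cong[where f="emeasure lborel"])
    ultimately have "ennreal q * emeasure lborel (?E \<inter> ball 0 R) \<le> ennreal p * emeasure lborel U"
      using * by simp
    then have "ennreal (1/q) * (ennreal q * emeasure lborel (?E \<inter> ball 0 R)) \<le> ennreal (1/q) * (ennreal p * emeasure lborel U)"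
      by (rule mult_left_mono) simp
    then show "emeasure lborel (?E \<inter> ball 0 R) \<le> ennreal (p / q) * emeasure lborel U"
      using pq by (simp add: mult.assoc[symmetric] ennreal_mult[symmetric])
  qed (use E pq in \<open>auto intro!: bounded_Int\<close>)
  have "?E = (\<Union>n. ?E \<inter> ball 0 (real n))"
    by (auto simp: reals_Archimedean2)
  also have "\<dots> \<in> null_sets lborel"
    using E 0 by (intro null_sets_UN) (auto simp: null_sets_def)
  finally show ?thesis .
qed

lemma slope_tendsto_iff:
  "(slope g x \<longlongrightarrow> D) (at 0) \<longleftrightarrow> (g has_real_derivative D) (at x)"
  unfolding slope_def DERIV_def ..

text \<open>If Liminf and Limsup differ, two rationals separate them; boundedness keeps a common
  value finite. Rational pairs leave countably many conditions, so null sets can be united and Borel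
  sets combined.\<close>

lemma convergent_iff_not_oscillating:
  fixes s :: "'b \<Rightarrow> real"
  assumes F: "F \<noteq> bot" and bnd: "\<And>h. \<bar>s h\<bar> \<le> K"
  shows "(\<exists>D. (s \<longlongrightarrow> D) F) \<longleftrightarrow>
    (\<forall>p\<in>\<rat>. \<forall>q\<in>\<rat>. p < q \<longrightarrow> \<not> ((\<exists>\<^sub>F h in F. s h < p) \<and> (\<exists>\<^sub>F h in F. q < s h)))"
    (is "?L \<longleftrightarrow> ?R")
proof
  assume ?L
  then obtain D where D: "(s \<longlongrightarrow> D) F" by blast
  have "p \<ge> D" if "\<exists>\<^sub>F h in F. s h < p" for p
  proof (rule ccontr)
    assume "\<not> ?thesis"
    then have "\<forall>\<^sub>F h in F. \<not> s h < p"
      using order_tendstoD(1)[OF D, of p] by (auto elim!: eventually_mono)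
    then show False using that by (simp add: frequently_def)
  qed
  moreover have "q \<le> D" if "\<exists>\<^sub>F h in F. q < s h" for q
  proof (rule ccontr)
    assume "\<not> ?thesis"
    then have "\<forall>\<^sub>F h in F. \<not> q < s h"
      using order_tendstoD(2)[OF D, of q] by (auto elim!: eventually_mono)
    then show False using that by (simp add: frequently_def)
  qed
  ultimately show ?R by force
next
  assume R: ?R
  let ?s = "\<lambda>h. ereal (s h)"
  have lo: "ereal (- K) \<le> Liminf F ?s" and up: "Limsup F ?s \<le> ereal K"
    using bnd by (auto intro!: Liminf_bounded Limsup_bounded always_eventually simp: abs_le_iff minus_le_iff)
  have le: "Liminf F ?s \<le> Limsup F ?s" by (rule Liminf_le_Limsup[OF F])
  have "\<not> Liminf F ?s < Limsup F ?s"
  proof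
    assume "Liminf F ?s < Limsup F ?s"
    then obtain p where p: "Liminf F ?s < ereal (real_of_rat p)" "ereal (real_of_rat p) < Limsup F ?s"
      using ereal_dense3 by blast
    then obtain q where q: "ereal (real_of_rat p) < ereal (real_of_rat q)" "ereal (real_of_rat q) < Limsup F ?s"
      using ereal_dense3 by blast
    have "\<exists>\<^sub>F h in F. s h < real_of_rat p"
    proof (rule ccontr)
      assume "\<not> ?thesis"
      then have "\<forall>\<^sub>F h in F. ereal (real_of_rat p) \<le> ?s h"
        by (simp add: not_frequently not_less)
      then have "ereal (real_of_rat p) \<le> Liminf F ?s" by (rule Liminf_bounded)
      then show False using p(1) by simp
    qed
    moreover have "\<exists>\<^sub>F h in F. real_of_rat q < s h"
    proof (rule ccontr)
      assume "\<not> ?thesis"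
      then have "\<forall>\<^sub>F h in F. ?s h \<le> ereal (real_of_rat q)"
        by (simp add: not_frequently not_less)
      then have "Limsup F ?s \<le> ereal (real_of_rat q)" by (rule Limsup_bounded)
      then show False using q(2) by simp
    qed
    moreover have "real_of_rat p < real_of_rat q" using q(1) by simp
    ultimately show False using R Rats_of_rat by blast
  qed
  then have eq: "Limsup F ?s = Liminf F ?s" using le by simp
  obtain D where D: "Limsup F ?s = ereal D"
    using lo up unfolding eq by (cases "Liminf F ?s" rule: ereal_cases) simp_all
  have "(?s \<longlongrightarrow> ereal D) F"
    using eq D by (intro Liminf_eq_Limsup F) auto
  then show ?L by auto
qed

lemma AE_differentiable_mono_lipschitz:
  fixes g :: "real \<Rightarrow> real"
  assumes g: "mono g" and lip: "L-lipschitz_on UNIV g"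
  shows "AE x in lborel. g differentiable (at x)"
proof -
  have cont: "continuous_on UNIV g" using lip by (rule lipschitz_on_continuous_on)
  define E where "E p q = {x. (\<exists>\<^sub>F h in at 0. slope g x h < p) \<and> (\<exists>\<^sub>F h in at 0. q < slope g x h)}" for p q
  have "AE x in lborel. \<forall>p\<in>\<rat>. \<forall>q\<in>\<rat>. 0 \<le> p \<and> p < q \<longrightarrow> x \<notin> E p q"
  proof (intro AE_ball_countable[THEN iffD2] ballI countable_rat)
    fix p q :: real
    show "AE x in lborel. 0 \<le> p \<and> p < q \<longrightarrow> x \<notin> E p q"
      using null_oscillating_slope[OF g cont, of p q] AE_not_in[of "E p q" lborel]
      by (auto simp: E_def[symmetric])
  qed
  then show ?thesis
  proof (rule AE_mp, intro AE_I2 impI)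
    fix x assume x: "\<forall>p\<in>\<rat>. \<forall>q\<in>\<rat>. 0 \<le> p \<and> p < q \<longrightarrow> x \<notin> E p q"
    have nonneg: "0 \<le> slope g x h" for h
      using monoD[OF g, of x "x + h"] monoD[OF g, of "x + h" x]
      by (cases h "0::real" rule: linorder_cases) (auto simp: slope_def divide_nonpos_neg)
    have bnd: "\<bar>slope g x h\<bar> \<le> L" for h
    proof -
      have "\<bar>g (x + h) - g x\<bar> \<le> L * \<bar>h\<bar>"
        using lipschitz_onD[OF lip, of "x + h" x] by (simp add: dist_real_def)
      then show ?thesis
        using lipschitz_on_nonneg[OF lip] by (auto simp: slope_def divide_le_eq)
    qed
    \<comment> \<open>Negative p is not covered by \<open>null_oscillating_slope\<close>, but slopes
      of a monotone function are never negative.\<close>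
    have "\<not> (\<exists>\<^sub>F h in at 0. slope g x h < p)" if "p < 0" for p
    proof -
      have "\<not> slope g x h < p" for h using nonneg[of h] that by linarith
      then show ?thesis by (simp add: frequently_def)
    qed
    then have "\<exists>D. (slope g x \<longlongrightarrow> D) (at 0)"
      using x unfolding convergent_iff_not_oscillating[of "at 0" "slope g x", OF at_neq_bot bnd] E_def mem_Collect_eq
      by (meson not_le)
    then show "g differentiable (at x)"
      by (auto simp: slope_tendsto_iff real_differentiable_def)
  qed
qed

lemma AE_differentiable_lipschitz_real:
  fixes g :: "real \<Rightarrow> real"
  assumes lip: "L-lipschitz_on UNIV g"
  shows "AE x in lborel. g differentiable (at x)"
proof -
  \<comment> \<open>Adding a linear function reduces to the monotone case.\<close>
  have "mono (\<lambda>x. g x + L * x)"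
  proof (rule monoI)
    fix x y :: real assume "x \<le> y"
    then have "\<bar>g x - g y\<bar> \<le> L * (y - x)"
      using lipschitz_onD[OF lip, of x y] by (simp add: dist_real_def)
    then show "g x + L * x \<le> g y + L * y" by (simp add: right_diff_distrib)
  qed
  moreover have "(L + \<bar>L\<bar> * 1)-lipschitz_on UNIV (\<lambda>x. g x + L * x)"
    by (intro lipschitz_intros lip)
  ultimately have "AE x in lborel. (\<lambda>x. g x + L * x) differentiable (at x)"
    by (rule AE_differentiable_mono_lipschitz)
  then show ?thesis
  proof (rule AE_mp, intro AE_I2 impI)
    fix x assume "(\<lambda>x. g x + L * x) differentiable (at x)"
    then have "(\<lambda>x. (g x + L * x) - L * x) differentiable (at x)"
      by (intro differentiable_diff) auto
    then show "g differentiable (at x)" by simp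
  qed
qed

section \<open>Null sets by slicing, and directional derivatives\<close>

lemma nn_integral_lborel_translation:
  fixes f :: "'a::euclidean_space \<Rightarrow> ennreal"
  assumes "f \<in> borel_measurable borel"
  shows "(\<integral>\<^sup>+x. f (x + c) \<partial>lborel) = (\<integral>\<^sup>+x. f x \<partial>lborel)"
proof -
  have "(\<integral>\<^sup>+x. f x \<partial>lborel) = (\<integral>\<^sup>+x. f x \<partial>distr lborel borel ((+) c))"
    by (simp add: lborel_distr_plus)
  also have "\<dots> = (\<integral>\<^sup>+x. f (c + x) \<partial>lborel)"
    using assms by (intro nn_integral_distr) auto
  finally show ?thesis by (simp add: add.commute)
qed

text \<open>Translation by t v does not change the measure of \<open>N\<close>. Averaging over t in
  [0,1] and exchanging the integrals leaves, for each x, the length of the set of those t for which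
  x + t v lies in \<open>N\<close>, which is 0.\<close>

lemma null_set_of_null_lines:
  fixes N :: "'a::euclidean_space set" and v :: 'a
  assumes N[measurable]: "N \<in> sets borel"
    and line: "\<And>x. AE t in lborel. x + t *\<^sub>R v \<notin> N"
  shows "N \<in> null_sets lborel"
proof -
  have "emeasure lborel N = (\<integral>\<^sup>+t. emeasure lborel N * indicator {0..1} t \<partial>(lborel :: real measure))"
    by (simp add: nn_integral_cmult_indicator)
  also have "\<dots> = (\<integral>\<^sup>+t. (\<integral>\<^sup>+x. indicator N (x + t *\<^sub>R v) * indicator {0..1} t \<partial>lborel) \<partial>(lborel :: real measure))"
  proof (rule nn_integral_cong)
    fix t :: real
    have "emeasure lborel N = (\<integral>\<^sup>+x. indicator N (x + t *\<^sub>R v) \<partial>lborel)"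
      by (subst nn_integral_lborel_translation) auto
    then show "emeasure lborel N * indicator {0..1} t =
        (\<integral>\<^sup>+x. indicator N (x + t *\<^sub>R v) * indicator {0..1} t \<partial>lborel)"
      by (simp add: nn_integral_multc)
  qed
  also have "\<dots> = (\<integral>\<^sup>+x. (\<integral>\<^sup>+t. indicator N (x + t *\<^sub>R v) * indicator {0..1::real} t \<partial>lborel) \<partial>lborel)"
    by (rule lborel_pair.Fubini') measurable
  also have "\<dots> = (\<integral>\<^sup>+x. 0 \<partial>(lborel :: 'a measure))"
  proof (rule nn_integral_cong)
    fix x
    have "(\<integral>\<^sup>+t. indicator N (x + t *\<^sub>R v) * indicator {0..1::real} t \<partial>lborel) = (\<integral>\<^sup>+(t::real). 0 \<partial>lborel)"
      by (rule nn_integral_cong_AE, use line[of x] in eventually_elim) simp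
    then show "(\<integral>\<^sup>+t. indicator N (x + t *\<^sub>R v) * indicator {0..1::real} t \<partial>lborel) = 0" by simp
  qed
  finally show ?thesis by (auto simp: null_sets_def)
qed

definition dquot :: "('a::real_normed_vector \<Rightarrow> real) \<Rightarrow> 'a \<Rightarrow> 'a \<Rightarrow> real \<Rightarrow> real" where
  "dquot f v x h = (f (x + h *\<^sub>R v) - f x) / h"

definition directional_derivative_exists :: "('a::real_normed_vector \<Rightarrow> real) \<Rightarrow> 'a \<Rightarrow> 'a \<Rightarrow> bool" where
  "directional_derivative_exists f v x \<longleftrightarrow> (\<lambda>t. f (x + t *\<^sub>R v)) differentiable (at 0)"

lemma directional_derivative_exists_shift:
  "directional_derivative_exists f v (x + t *\<^sub>R v) \<longleftrightarrow> (\<lambda>t. f (x + t *\<^sub>R v)) differentiable (at t)"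
  unfolding directional_derivative_exists_def real_differentiable_def DERIV_def
  by (simp add: scaleR_left_distrib add_ac)

lemma directional_derivative_exists_iff_dquot:
  "directional_derivative_exists f v x \<longleftrightarrow> (\<exists>D. (dquot f v x \<longlongrightarrow> D) (at 0))"
  unfolding directional_derivative_exists_def real_differentiable_def DERIV_def dquot_def by simp

lemma abs_dquot_le:
  assumes "L-lipschitz_on UNIV f"
  shows "\<bar>dquot f v x h\<bar> \<le> L * norm v"
proof -
  have "\<bar>f (x + h *\<^sub>R v) - f x\<bar> \<le> L * (\<bar>h\<bar> * norm v)"
    using lipschitz_onD[OF assms, of "x + h *\<^sub>R v" x] by (simp add: dist_norm)
  then show ?thesis
    using lipschitz_on_nonneg[OF assms] by (auto simp: dquot_def divide_le_eq mult_ac)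
qed

text \<open>Slicing along lines asks for a Borel exceptional set. It is the union over rational p <
  q of the sets where the quotient oscillates across [p, q], each Borel because the quotient is
  continuous in x.\<close>

lemma sets_not_directional_derivative_exists:
  fixes f :: "'a::euclidean_space \<Rightarrow> real"
  assumes lip: "L-lipschitz_on UNIV f"
  shows "{x. \<not> directional_derivative_exists f v x} \<in> sets borel"
proof -
  have cont: "continuous_on UNIV f" using lip by (rule lipschitz_on_continuous_on)
  have c: "continuous_on UNIV (\<lambda>x. dquot f v x h)" for h
    unfolding dquot_def divide_inverse
    by (intro continuous_intros continuous_on_compose2[OF cont]) auto
  define E where "E p q = {x. \<exists>\<^sub>F h in at 0. dquot f v x h < p} \<inter> {x. \<exists>\<^sub>F h in at 0. q < dquot f v x h}" for p q
  have "E p q \<in> sets borel" for p q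
    unfolding E_def by (intro sets.Int sets_frequently_at_0 open_Collect_less c continuous_intros)
  moreover have "{x. \<not> directional_derivative_exists f v x} = (\<Union>p\<in>\<rat>. \<Union>q\<in>{q\<in>\<rat>. p < q}. E p q)"
    unfolding directional_derivative_exists_iff_dquot
      convergent_iff_not_oscillating[of "at 0" "dquot f v _", OF at_neq_bot abs_dquot_le[OF lip]]
    by (auto simp: E_def)
  moreover have "countable {q\<in>\<rat>. p < q}" for p :: real
    using countable_rat by (rule countable_subset[rotated]) auto
  ultimately show ?thesis
    by (auto intro!: sets.countable_UN' countable_rat)
qed

lemma AE_directional_derivative_exists:
  fixes f :: "'a::euclidean_space \<Rightarrow> real"
  assumes lip: "L-lipschitz_on UNIV f"
  shows "AE x in lborel. directional_derivative_exists f v x"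
proof -
  have "{x. \<not> directional_derivative_exists f v x} \<in> null_sets lborel"
  proof (rule null_set_of_null_lines[where v=v])
    fix x
    have "(L * norm v)-lipschitz_on UNIV (\<lambda>t. f (x + t *\<^sub>R v))"
    proof (rule lipschitz_onI)
      fix s t :: real
      have "dist (f (x + s *\<^sub>R v)) (f (x + t *\<^sub>R v)) \<le> L * dist (x + s *\<^sub>R v) (x + t *\<^sub>R v)"
        by (rule lipschitz_onD[OF lip]) auto
      also have "dist (x + s *\<^sub>R v) (x + t *\<^sub>R v) = norm v * dist s t"
        by (simp add: dist_norm dist_real_def flip: scaleR_diff_left)
      finally show "dist (f (x + s *\<^sub>R v)) (f (x + t *\<^sub>R v)) \<le> L * norm v * dist s t"
        by (simp add: mult.assoc)
    qed (use lipschitz_on_nonneg[OF lip] in auto)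
    from AE_differentiable_lipschitz_real[OF this]
    show "AE t in lborel. x + t *\<^sub>R v \<notin> {x. \<not> directional_derivative_exists f v x}"
      by (simp add: directional_derivative_exists_shift)
  qed (rule sets_not_directional_derivative_exists[OF lip])
  then have "AE x in lborel. x \<notin> {x. \<not> directional_derivative_exists f v x}" by (rule AE_not_in)
  then show ?thesis by simp
qed

section \<open>From partial derivatives to the total derivative\<close>

text \<open>A weak form of Lebesgue's density theorem. At a bad point x of \<open>A\<close> there
  are arbitrarily small h such that the ball of radius e |h| about x + h misses \<open>A\<close>. In
  the ball of radius (1 + e) |h| about x, the set \<open>A\<close> then fills at most the fraction c
  = 1 - (e / (1 + e))^n, and a Vitali covering by such balls turns this local loss into a
  contraction.\<close>

lemma AE_not_porous:
  fixes A :: "'a::euclidean_space set"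
  assumes A: "closed A" and e: "0 < e"
  shows "AE x in lborel. x \<in> A \<longrightarrow> (\<forall>\<^sub>F h in at 0. \<exists>y\<in>A. dist (x + h) y \<le> e * norm h)"
proof -
  define Q where "Q x h \<longleftrightarrow> (\<forall>y\<in>A. e * norm h < dist (x + h) y)" for x h
  define P where "P = {x\<in>A. \<exists>\<^sub>F h in at 0. Q x h}"
  have openQ: "open {x. Q x h}" for h
  proof (cases "A = {}")
    case False
    \<comment> \<open>\<open>A\<close> is closed, so the distance to \<open>A\<close> is attained
      and the strict bounds amount to one strict bound on a continuous function of x.\<close>
    have "{x. Q x h} = {x. e * norm h < infdist (x + h) A}"
    proof (intro Collect_cong iffI)
      fix x
      obtain y where "y \<in> A" "infdist (x + h) A = dist (x + h) y"
        using infdist_attains_inf[OF A False] by blast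
      then show "e * norm h < infdist (x + h) A" if "Q x h" using that by (auto simp: Q_def)
      show "Q x h" if "e * norm h < infdist (x + h) A"
        using that infdist_le unfolding Q_def by (meson less_le_trans)
    qed
    then show ?thesis by (auto intro!: open_Collect_less continuous_intros)
  qed (simp add: Q_def)
  have freq: "(\<exists>\<^sub>F h in at 0. Q x h) \<longleftrightarrow> (\<forall>n. \<exists>h\<in>{h. h \<noteq> 0 \<and> norm h < 1 / real (Suc n)}. Q x h)" for x
  proof
    show "\<forall>n. \<exists>h\<in>{h. h \<noteq> 0 \<and> norm h < 1 / real (Suc n)}. Q x h" if "\<exists>\<^sub>F h in at 0. Q x h"
      using that by (auto simp: frequently_at)
    assume *: "\<forall>n. \<exists>h\<in>{h. h \<noteq> 0 \<and> norm h < 1 / real (Suc n)}. Q x h"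
    show "\<exists>\<^sub>F h in at 0. Q x h"
      unfolding frequently_at
    proof (intro allI impI)
      fix d :: real assume "d > 0"
      then obtain n where "1 / real (Suc n) < d" by (metis nat_approx_posE)
      moreover obtain h where "h \<noteq> 0" "norm h < 1 / real (Suc n)" "Q x h" using * by blast
      ultimately show "\<exists>h\<in>UNIV. h \<noteq> 0 \<and> dist h 0 < d \<and> Q x h" by auto
    qed
  qed
  have P: "P \<in> sets borel"
  proof -
    have "P = A \<inter> (\<Inter>n. \<Union>h\<in>{h. h \<noteq> 0 \<and> norm h < 1 / real (Suc n)}. {x. Q x h})"
      by (auto simp: P_def freq)
    moreover have "open (\<Union>h\<in>{h. h \<noteq> 0 \<and> norm h < 1 / real (Suc n)}. {x. Q x h})" for n
      using openQ by auto
    ultimately show ?thesis using A by auto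
  qed
  define n where "n = DIM('a)"
  define c where "c = 1 - (e / (1 + e)) ^ n"
  have c: "0 \<le> c" "c < 1" using e by (auto simp: c_def power_le_one)
  \<comment> \<open>Lebesgue measure restricted to \<open>A\<close>: the bad set \<open>P\<close>
    lies in \<open>A\<close>, so a bound on \<open>M\<close> for an open set bounds the part of
    \<open>P\<close> in it.\<close>
  define M where "M = density lborel (indicator A)"
  have sM: "sets M = sets borel" by (simp add: M_def)
  have M: "emeasure M S = emeasure lborel (A \<inter> S)" if "S \<in> sets borel" for S
    using that A by (auto simp: M_def emeasure_density indicator_inter_arith[symmetric] Int_commute)
  have 0: "emeasure lborel (P \<inter> ball 0 R) = 0" for R
  proof (rule emeasure_0_of_outer_contraction[OF _ _ c])
    fix U assume U: "open U" "P \<inter> ball 0 R \<subseteq> U"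
    have "\<exists>a r. 0 < r \<and> r < d \<and> x \<in> cball a r \<and>
        emeasure M (cball a r) \<le> ennreal c * emeasure lborel (cball a r)"
      if x: "x \<in> P \<inter> ball 0 R" "0 < d" for x d
    proof -
      have "0 < d / (1 + e)" using x e by simp
      moreover have "\<exists>\<^sub>F h in at 0. Q x h" using x by (simp add: P_def)
      ultimately obtain h where h: "h \<noteq> 0" "norm h < d / (1 + e)" "Q x h"
        unfolding frequently_at by force
      define r where "r = (1 + e) * norm h"
      have r: "0 < r" "r < d" "norm h \<le> r" "0 < e * norm h" "e * norm h \<le> r"
        using h e by (auto simp: r_def field_simps intro!: add_pos_pos)
      have sub: "ball (x + h) (e * norm h) \<subseteq> cball x r"
      proof
        fix y assume "y \<in> ball (x + h) (e * norm h)"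
        then have "dist (x + h) y < e * norm h" by simp
        moreover have "dist x y \<le> dist x (x + h) + dist (x + h) y" by (rule dist_triangle)
        ultimately have "dist x y \<le> norm h + e * norm h" by (simp add: dist_norm)
        then show "y \<in> cball x r" by (simp add: r_def algebra_simps)
      qed
      have "A \<inter> cball x r \<subseteq> cball x r - ball (x + h) (e * norm h)"
        using h(3) by (force simp: Q_def)
      moreover have fin: "emeasure lborel S < top" if "S \<subseteq> cball x r" for S
        using emeasure_bounded_finite[OF bounded_subset[OF bounded_cball that]] by simp
      ultimately have "measure lborel (A \<inter> cball x r) \<le> measure lborel (cball x r - ball (x + h) (e * norm h))"
        using A fin[of "cball x r - ball (x + h) (e * norm h)"]
        by (intro measure_mono_fmeasurable) (auto simp: fmeasurable_def)
      also have "\<dots> = measure lborel (cball x r) - measure lborel (ball (x + h) (e * norm h))"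
        using sub fin[of "cball x r"] by (intro measure_Diff) auto
      also have "\<dots> = unit_ball_vol n * (r ^ n - (e * norm h) ^ n)"
        using r by (simp add: content_ball content_cball n_def algebra_simps)
      also have "(e * norm h) ^ n = (e / (1 + e)) ^ n * r ^ n"
        using e by (simp add: r_def power_mult_distrib power_divide)
      also have "unit_ball_vol n * (r ^ n - (e / (1 + e)) ^ n * r ^ n) = c * measure lborel (cball x r)"
        using r by (simp add: content_cball n_def c_def algebra_simps)
      finally have "measure lborel (A \<inter> cball x r) \<le> c * measure lborel (cball x r)" .
      moreover have "emeasure lborel (A \<inter> cball x r) = measure lborel (A \<inter> cball x r)"
        using fin[of "A \<inter> cball x r"] by (intro emeasure_eq_ennreal_measure) auto
      moreover have "emeasure lborel (cball x r) = measure lborel (cball x r)"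
        using fin[of "cball x r"] by (intro emeasure_eq_ennreal_measure) auto
      ultimately have "emeasure M (cball x r) \<le> ennreal c * emeasure lborel (cball x r)"
        using c by (simp add: M ennreal_mult'[symmetric] ennreal_leI)
      then show ?thesis using r by (intro exI[of _ x] exI[of _ r]) simp
    qed
    from Vitali_open_subset[OF sM U this]
    obtain W where W: "open W" "W \<subseteq> U" "negligible (P \<inter> ball 0 R - W)"
      "emeasure M W \<le> ennreal c * emeasure lborel U" by metis
    have "emeasure lborel (P \<inter> ball 0 R - W) = 0"
      using W P by (auto simp: negligible_iff_null_sets null_sets_completion_iff null_sets_def)
    moreover have "emeasure lborel (P \<inter> ball 0 R) =
       emeasure lborel (P \<inter> ball 0 R \<inter> W) + emeasure lborel (P \<inter> ball 0 R - W)"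
      using P W by (subst plus_emeasure) (auto intro!: arg_cong[where f="emeasure lborel"])
    moreover have "emeasure lborel (P \<inter> ball 0 R \<inter> W) \<le> emeasure M W"
      using W(1) A unfolding M[OF borel_open[OF W(1)]] by (intro emeasure_mono) (auto simp: P_def)
    ultimately show "emeasure lborel (P \<inter> ball 0 R) \<le> ennreal c * emeasure lborel U"
      using W(4) by simp
  qed (use P in \<open>auto intro!: bounded_Int\<close>)
  have "P = (\<Union>n. P \<inter> ball 0 (real n))"
    by (auto simp: reals_Archimedean2)
  also have "\<dots> \<in> null_sets lborel"
    using P 0 by (intro null_sets_UN) (auto simp: null_sets_def)
  finally have "AE x in lborel. x \<notin> P" by (rule AE_not_in)
  then show ?thesis
    by (rule AE_mp) (auto intro!: AE_I2 simp: P_def Q_def not_frequently not_less Ball_def Bex_def)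
qed

lemma AE_differentiable_lipschitz:
  fixes f :: "'a::euclidean_space \<Rightarrow> real"
  assumes lip: "L-lipschitz_on UNIV f"
  shows "AE x in lborel. f differentiable (at x)"
proof -
  have L: "0 \<le> L" using lip by (rule lipschitz_on_nonneg)
  have cont: "continuous_on UNIV f" using lip by (rule lipschitz_on_continuous_on)
  \<comment> \<open>Points from which f changes along every coordinate direction almost like the
    linear form a, uniformly up to step length d. Continuity of f makes these sets closed.
    Tolerances 1 / (k + 1), lengths 1 / (m + 1) and a in a countable dense set give countably many
    of them, so almost every x is a non-porous point of all those that contain it.\<close>
  define G where "G e a d = {y. \<forall>b\<in>Basis. \<forall>t\<in>{-d..d}.
      \<bar>f (y + t *\<^sub>R b) - f y - t * (a \<bullet> b)\<bar> \<le> e * \<bar>t\<bar>}" for e d :: real and a :: 'a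
  have closedG: "closed (G e a d)" for e a d
  proof -
    have "closed {y. \<bar>f (y + t *\<^sub>R b) - f y - t * (a \<bullet> b)\<bar> \<le> e * \<bar>t\<bar>}" for t and b :: 'a
      by (intro closed_Collect_le continuous_intros continuous_on_compose2[OF cont]) auto
    moreover have "G e a d = (\<Inter>b\<in>Basis. \<Inter>t\<in>{-d..d}.
        {y. \<bar>f (y + t *\<^sub>R b) - f y - t * (a \<bullet> b)\<bar> \<le> e * \<bar>t\<bar>})"
      by (auto simp: G_def)
    ultimately show ?thesis by (simp add: closed_INT)
  qed
  obtain T :: "'a set" where T: "countable T" "\<And>X. open X \<Longrightarrow> X \<noteq> {} \<Longrightarrow> \<exists>a\<in>T. a \<in> X"
    using countable_dense_exists by blast
  have "AE x in lborel. \<forall>k::nat. \<forall>a\<in>T. \<forall>m::nat. x \<in> G (1 / Suc k) a (1 / Suc m) \<longrightarrow>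
      (\<forall>\<^sub>F h in at 0. \<exists>y\<in>G (1 / Suc k) a (1 / Suc m). dist (x + h) y \<le> 1 / Suc k * norm h)"
    by (intro AE_all_countable[THEN iffD2] AE_ball_countable[THEN iffD2] allI ballI T(1)
        AE_not_porous closedG) simp
  moreover have "AE x in lborel. \<forall>b\<in>Basis. directional_derivative_exists f b x"
    by (intro AE_ball_countable[THEN iffD2] ballI AE_directional_derivative_exists[OF lip]
        countable_finite) simp
  ultimately show ?thesis
  proof eventually_elim
    case (elim x)
    obtain D where D: "\<And>b. b \<in> Basis \<Longrightarrow> (dquot f b x \<longlongrightarrow> D b) (at 0)"
      using elim(2) unfolding directional_derivative_exists_iff_dquot by metis
    define g where "g = (\<Sum>b\<in>Basis. D b *\<^sub>R b)"
    have gb: "g \<bullet> b = D b" if "b \<in> Basis" for b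
      using that by (simp add: g_def inner_sum_left_Basis)
    have "(f has_derivative (\<lambda>h. g \<bullet> h)) (at x)"
      unfolding has_derivative_at_alt
    proof (intro conjI allI impI bounded_linear_inner_right)
      fix \<eta> :: real assume "\<eta> > 0"
      define N where "N = real DIM('a)"
      have N: "N > 0" by (simp add: N_def)
      \<comment> \<open>Error budget: each of the N coordinate steps costs (2 L + 1) e |h|, namely
        two Lipschitz moves and one increment from a point of \<open>G\<close>; replacing a by the
        gradient g costs at most N e |h|. The total is N (2 L + 2) e |h|.\<close>
      have "\<eta> / (N * (2 * L + 2)) > 0" using \<open>\<eta> > 0\<close> N L by (intro divide_pos_pos mult_pos_pos) auto
      then obtain k where k: "1 / real (Suc k) < \<eta> / (N * (2 * L + 2))" by (metis nat_approx_posE)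
      define e where "e = 1 / real (Suc k)"
      have e: "0 < e" "N * (2 * L + 2) * e \<le> \<eta>"
      proof -
        show "0 < e" by (simp add: e_def)
        have "0 < N * (2 * L + 2)" using N L by (intro mult_pos_pos) auto
        then show "N * (2 * L + 2) * e \<le> \<eta>"
          using k unfolding e_def[symmetric] by (simp add: pos_less_divide_eq mult.commute)
      qed
      \<comment> \<open>Half of the tolerance is spent on the distance from g to the dense set, the
        other half on the difference quotients at x; together they place x in
        \<open>G e a \<delta>\<close>.\<close>
      obtain a where a: "a \<in> T" "dist g a < e / 2"
        using T(2)[of "ball g (e / 2)"] e by auto
      have ab: "\<bar>a \<bullet> b - D b\<bar> \<le> e / 2" if "b \<in> Basis" for b
        using Basis_le_norm[OF that, of "a - g"] a gb[OF that] by (simp add: inner_diff_left dist_norm norm_minus_commute)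
      have "\<forall>\<^sub>F t in at 0. \<forall>b\<in>Basis. dist (dquot f b x t) (D b) < e / 2"
        using e(1) by (intro eventually_ball_finite finite_Basis ballI tendstoD[OF D]) simp_all
      then obtain d where d: "d > 0" "\<And>t b. t \<noteq> 0 \<Longrightarrow> \<bar>t\<bar> < d \<Longrightarrow> b \<in> Basis \<Longrightarrow> dist (dquot f b x t) (D b) < e / 2"
        unfolding eventually_at by auto
      obtain m where m: "1 / real (Suc m) < d" using \<open>d > 0\<close> by (metis nat_approx_posE)
      define \<delta> where "\<delta> = 1 / real (Suc m)"
      have "x \<in> G e a \<delta>"
        unfolding G_def
      proof (intro CollectI ballI)
        fix b :: 'a and t assume b: "b \<in> Basis" and t: "t \<in> {-\<delta>..\<delta>}"
        show "\<bar>f (x + t *\<^sub>R b) - f x - t * (a \<bullet> b)\<bar> \<le> e * \<bar>t\<bar>"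
        proof (cases "t = 0")
          case False
          have "\<bar>t\<bar> < d" using t m by (auto simp: \<delta>_def)
          then have "\<bar>dquot f b x t - D b\<bar> < e / 2" using d(2)[OF False _ b] by (simp add: dist_real_def)
          then have "\<bar>dquot f b x t - a \<bullet> b\<bar> \<le> e" using ab[OF b] by linarith
          then have "\<bar>t\<bar> * \<bar>dquot f b x t - a \<bullet> b\<bar> \<le> \<bar>t\<bar> * e" by (rule mult_left_mono) simp
          also have "\<bar>t\<bar> * \<bar>dquot f b x t - a \<bullet> b\<bar> = \<bar>f (x + t *\<^sub>R b) - f x - t * (a \<bullet> b)\<bar>"
            unfolding abs_mult[symmetric] right_diff_distrib using False by (simp add: dquot_def)
          finally show ?thesis by (simp add: mult.commute)
        qed simp
      qed
      then have "\<forall>\<^sub>F h in at 0. \<exists>y\<in>G e a \<delta>. dist (x + h) y \<le> e * norm h"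
        using elim(1) a(1) unfolding e_def \<delta>_def by blast
      then obtain d' where d': "d' > 0"
        "\<And>h. h \<noteq> 0 \<Longrightarrow> norm h < d' \<Longrightarrow> \<exists>y\<in>G e a \<delta>. dist (x + h) y \<le> e * norm h"
        unfolding eventually_at by auto
      have near: "\<exists>y\<in>G e a \<delta>. dist (x + h) y \<le> e * norm h" if "norm h < d'" for h
        using d'(2)[of h] that \<open>x \<in> G e a \<delta>\<close> by (cases "h = 0") auto
      show "\<exists>d>0. \<forall>y. norm (y - x) < d \<longrightarrow> norm (f y - f x - g \<bullet> (y - x)) \<le> \<eta> * norm (y - x)"
      proof (intro exI[of _ "min d' \<delta>"] conjI allI impI)
        show "0 < min d' \<delta>" using d' by (simp add: \<delta>_def)
        fix z assume z: "norm (z - x) < min d' \<delta>"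
        define h where "h = z - x"
        have h: "norm h < d'" "norm h < \<delta>" using z by (auto simp: h_def)
        \<comment> \<open>Walk from \<open>x\<close> to \<open>x + h\<close> one coordinate at a time; each corner is moved to a nearby
          point of \<open>G e a \<delta>\<close>, where the partial derivatives are known, at the cost of the Lipschitz
          constant.\<close>
        define w where "w S = (\<Sum>b\<in>S. (h \<bullet> b) *\<^sub>R b)" for S
        have w: "norm (w S) \<le> norm h" if "S \<subseteq> Basis" for S
        proof (rule norm_le_componentwise)
          fix b :: 'a assume "b \<in> Basis"
          have "w S \<bullet> b = (\<Sum>c\<in>S. if c = b then h \<bullet> b else 0)"
            using that \<open>b \<in> Basis\<close> unfolding w_def inner_sum_left
            by (intro sum.cong) (auto simp: inner_Basis subset_iff)
          then show "\<bar>w S \<bullet> b\<bar> \<le> \<bar>h \<bullet> b\<bar>"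
            using finite_subset[OF that finite_Basis] by (simp add: sum.delta)
        qed
        have step: "\<bar>f (x + w S) - f x - a \<bullet> w S\<bar> \<le> real (card S) * ((2 * L + 1) * e * norm h)"
          if "finite S" "S \<subseteq> Basis" for S
          using that
        proof (induction S rule: finite_induct)
          case empty
          then show ?case by (simp add: w_def)
        next
          case (insert b S)
          define t where "t = h \<bullet> b"
          have t: "\<bar>t\<bar> \<le> norm h" using insert.prems by (simp add: t_def Basis_le_norm)
          have wb: "w (insert b S) = w S + t *\<^sub>R b" using insert by (simp add: w_def t_def add.commute)
          have wS: "norm (w S) \<le> norm h" using insert.prems by (intro w) auto
          then obtain y where y: "y \<in> G e a \<delta>" "dist (x + w S) y \<le> e * norm (w S)"
            using near[of "w S"] h by auto
          have dy: "dist (x + w S) y \<le> e * norm h"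
            using y(2) mult_left_mono[OF wS, of e] e(1) by linarith
          have 1: "\<bar>f (x + w S + t *\<^sub>R b) - f (y + t *\<^sub>R b)\<bar> \<le> L * (e * norm h)"
            using lipschitz_onD[OF lip, of "x + w S + t *\<^sub>R b" "y + t *\<^sub>R b"] mult_left_mono[OF dy L]
            by (simp add: dist_real_def)
          have 2: "\<bar>f (x + w S) - f y\<bar> \<le> L * (e * norm h)"
            using lipschitz_onD[OF lip, of "x + w S" y] mult_left_mono[OF dy L]
            by (simp add: dist_real_def)
          have "\<bar>f (y + t *\<^sub>R b) - f y - t * (a \<bullet> b)\<bar> \<le> e * \<bar>t\<bar>"
          proof -
            have "t \<in> {-\<delta>..\<delta>}" using t h by (simp add: abs_le_iff)
            then show ?thesis using y(1) insert.prems unfolding G_def by blast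
          qed
          also have "\<dots> \<le> e * norm h" using t e by (intro mult_left_mono) auto
          finally have 3: "\<bar>f (y + t *\<^sub>R b) - f y - t * (a \<bullet> b)\<bar> \<le> e * norm h" .
          have "\<bar>f (x + w S + t *\<^sub>R b) - f (x + w S) - t * (a \<bullet> b)\<bar> \<le> (2 * L + 1) * e * norm h"
            using 1 2 3 by (simp add: algebra_simps)
          then have "\<bar>f (x + w (insert b S)) - f x - a \<bullet> w (insert b S)\<bar>
              \<le> real (card S) * ((2 * L + 1) * e * norm h) + (2 * L + 1) * e * norm h"
            using insert.IH insert.prems by (simp add: wb inner_add_right add.assoc)
          then show ?case using insert.hyps by (simp add: algebra_simps)
        qed
        have wB: "w Basis = h" by (simp add: w_def euclidean_representation)
        have 1: "\<bar>f (x + h) - f x - a \<bullet> h\<bar> \<le> N * ((2 * L + 1) * e * norm h)"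
          using step[of Basis] by (simp add: wB N_def)
        have "\<bar>a \<bullet> h - g \<bullet> h\<bar> \<le> norm (a - g) * norm h"
          using Cauchy_Schwarz_ineq2[of "a - g" h] by (simp add: inner_diff_left)
        also have "\<dots> \<le> (N * e) * norm h"
        proof (rule mult_right_mono)
          have "1 \<le> N" by (simp add: N_def Suc_leI)
          then have "1 * e \<le> N * e" using e(1) by (intro mult_right_mono) simp_all
          moreover have "norm (a - g) < e / 2" using a(2) by (simp add: dist_norm norm_minus_commute)
          ultimately show "norm (a - g) \<le> N * e" using e(1) by linarith
        qed simp
        finally have "\<bar>f (x + h) - f x - g \<bullet> h\<bar> \<le> N * ((2 * L + 1) * e * norm h) + N * e * norm h"
          using 1 by linarith
        also have "\<dots> = (N * (2 * L + 2) * e) * norm h" by (simp add: algebra_simps)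
        also have "\<dots> \<le> \<eta> * norm h" using e(2) by (rule mult_right_mono) simp
        finally show "norm (f z - f x - g \<bullet> (z - x)) \<le> \<eta> * norm (z - x)"
          by (simp add: h_def)
      qed
    qed
    then show ?case by (auto simp: differentiable_def)
  qed
qed

text \<open>On a compact ball the local Lipschitz constants become one constant. Composing with the
  closest-point projection, which is 1-Lipschitz and fixes the ball, extends f to the whole
  space.\<close>

lemma lipschitz_extension_of_local:
  fixes f :: "'a::euclidean_space \<Rightarrow> real"
  assumes loc: "\<And>x. \<exists>e>0. \<exists>L. L-lipschitz_on (ball x e) f"
  obtains F L where "L-lipschitz_on UNIV F" "\<And>x. norm x \<le> R \<Longrightarrow> F x = f x"
proof (cases "0 \<le> R")
  case True
  \<comment> \<open>\<open>local_lipschitz\<close> speaks of time-dependent maps; the one-point time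
    set makes f a constant family.\<close>
  have "local_lipschitz {0::real} (cball 0 R) (\<lambda>_. f)"
  proof (rule local_lipschitzI)
    fix x :: 'a
    obtain e L where e: "e > 0" "L-lipschitz_on (ball x e) f" using loc by blast
    have "L-lipschitz_on (cball x (e / 2) \<inter> cball 0 R) f"
      using e by (intro lipschitz_on_subset[OF e(2)]) auto
    then show "\<exists>u>0. \<exists>L. \<forall>t\<in>cball t u \<inter> {0::real}. L-lipschitz_on (cball x u \<inter> cball 0 R) f" for t
      using e(1) by (intro exI[of _ "e / 2"]) auto
  qed
  from local_lipschitz_compact_implies_lipschitz[OF this compact_cball]
  obtain L where L: "L-lipschitz_on (cball 0 R) f" by auto
  define p :: "'a \<Rightarrow> 'a" where "p = closest_point (cball 0 R)"
  have ne: "cball (0::'a) R \<noteq> {}" using True by simp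
  have p: "1-lipschitz_on UNIV p"
    using closest_point_lipschitz[OF convex_cball closed_cball ne]
    by (intro lipschitz_onI) (auto simp: p_def)
  have "range p \<subseteq> cball 0 R"
    using closest_point_in_set[OF closed_cball ne] unfolding p_def by blast
  then have "L-lipschitz_on (range p) f" by (rule lipschitz_on_subset[OF L])
  from lipschitz_on_compose2[OF p this]
  have "(L * 1)-lipschitz_on UNIV (\<lambda>x. f (p x))" .
  moreover have "f (p x) = f x" if "norm x \<le> R" for x
    using that by (simp add: p_def closest_point_self)
  ultimately show thesis by (intro that[of "L * 1" "\<lambda>x. f (p x)"]) auto
next
  case False
  show thesis
  proof (rule that)
    show "0-lipschitz_on UNIV (\<lambda>x::'a. 0::real)" by (rule lipschitz_on_constant)
    show "(0::real) = f x" if "norm x \<le> R" for x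
      using that False norm_ge_zero[of x] by linarith
  qed
qed

theorem Rademacher:
  fixes f :: "'a::euclidean_space \<Rightarrow> real"
  assumes loc: "\<And>x. \<exists>e>0. \<exists>L. L-lipschitz_on (ball x e) f"
  shows "AE x in lborel. f differentiable (at x)"
proof -
  have "AE x in lborel. norm x < real n \<longrightarrow> f differentiable (at x)" for n
  proof -
    obtain F L where F: "L-lipschitz_on UNIV F" "\<And>x. norm x \<le> real n \<Longrightarrow> F x = f x"
      using lipschitz_extension_of_local[OF loc] by metis
    from AE_differentiable_lipschitz[OF F(1)] show ?thesis
    proof (rule AE_mp, intro AE_I2 impI)
      fix x assume "F differentiable (at x)" and x: "norm x < real n"
      then obtain F' where "(F has_derivative F') (at x)" by (auto simp: differentiable_def)
      then have "(f has_derivative F') (at x)"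
        by (rule has_derivative_transform_within_open[of _ _ _ _ "ball 0 (real n)"]) (use x F(2) in auto)
      then show "f differentiable (at x)" by (auto simp: differentiable_def)
    qed
  qed
  then have "AE x in lborel. \<forall>n. norm x < real n \<longrightarrow> f differentiable (at x)"
    by (intro AE_all_countable[THEN iffD2] allI)
  then show ?thesis
    by eventually_elim (use reals_Archimedean2 in blast)
qed

section \<open>The gradient as an almost everywhere limit of difference quotients\<close>

lemma has_derivative_grad:
  assumes "f differentiable (at x)"
  shows "(f has_derivative (\<lambda>h. grad f x \<bullet> h)) (at x)"
proof -
  let ?D = "frechet_derivative f (at x)"
  have D: "(f has_derivative ?D) (at x)" using assms by (rule frechet_derivative_works[THEN iffD1])
  then interpret bounded_linear ?D by (rule has_derivative_bounded_linear)
  have "?D h = grad f x \<bullet> h" for h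
  proof -
    have "?D h = ?D (\<Sum>i\<in>UNIV. (h $ i) *\<^sub>R axis i 1)"
      using basis_expansion[of h] by (simp add: scalar_mult_eq_scaleR)
    also have "\<dots> = grad f x \<bullet> h"
      using assms by (simp add: sum scaleR grad_def inner_vec_def mult.commute)
    finally show ?thesis .
  qed
  then have "?D = (\<lambda>h. grad f x \<bullet> h)" by (rule ext)
  then show ?thesis using D by metis
qed

text \<open>\<open>frechet_derivative\<close> is a choice among derivatives, so it suffices that
  both functions have the same derivatives at x; this also covers points where neither is
  differentiable.\<close>

lemma grad_eq_of_eq_near:
  assumes "open S" "x \<in> S" "\<And>y. y \<in> S \<Longrightarrow> F y = f y"
  shows "grad F x = grad f x"
proof -
  have eq: "(F has_derivative D) (at x) \<longleftrightarrow> (f has_derivative D) (at x)" for D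
    using has_derivative_transform_within_open[of F D x UNIV S f]
      has_derivative_transform_within_open[of f D x UNIV S F] assms by auto
  then show ?thesis by (simp add: grad_def frechet_derivative_def differentiable_def)
qed

text \<open>The increments run through a sequence because limits of sequences preserve measurability
  and admit dominated convergence.\<close>

lemma tendsto_dquot_grad:
  assumes "f differentiable (at x)"
  shows "(\<lambda>m. dquot f v x (1 / real (Suc m))) \<longlonglongrightarrow> grad f x \<bullet> v"
proof -
  have "((\<lambda>t. f (x + t *\<^sub>R v)) has_derivative (\<lambda>t. grad f x \<bullet> (t *\<^sub>R v))) (at 0)"
    using has_derivative_grad[OF assms]
    by (intro has_derivative_compose[of "\<lambda>t. x + t *\<^sub>R v" "\<lambda>t. t *\<^sub>R v", where g=f]) (auto intro!: derivative_eq_intros)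
  then have "((\<lambda>t. f (x + t *\<^sub>R v)) has_real_derivative (grad f x \<bullet> v)) (at 0)"
    by (rule has_derivative_imp_has_field_derivative) simp
  then have "(dquot f v x \<longlongrightarrow> grad f x \<bullet> v) (at 0)"
    by (simp add: DERIV_def dquot_def[abs_def])
  moreover have "filterlim (\<lambda>m. 1 / real (Suc m)) (at 0) sequentially"
    using LIMSEQ_Suc[OF lim_1_over_n] by (auto simp: filterlim_at)
  ultimately show ?thesis by (rule filterlim_compose)
qed

text \<open>The domination passes to difference quotients in a fixed direction. In the direction v =
  grad g x it bounds |grad g x|^2 by c |grad f x \<bullet> v|, and Cauchy-Schwarz finishes.
  Truncations are thus handled without a chain rule at the kink.\<close>

lemma norm_grad_le_of_dominated:
  assumes f: "f differentiable (at x)" and g: "g differentiable (at x)"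
    and le: "\<And>y. \<bar>g y - g x\<bar> \<le> c * \<bar>f y - f x\<bar>" and c: "0 \<le> c"
  shows "norm (grad g x) \<le> c * norm (grad f x)"
proof -
  define v where "v = grad g x"
  have "(\<lambda>m. \<bar>dquot g v x (1 / real (Suc m))\<bar>) \<longlonglongrightarrow> \<bar>grad g x \<bullet> v\<bar>"
    by (intro tendsto_rabs tendsto_dquot_grad g)
  moreover have "(\<lambda>m. c * \<bar>dquot f v x (1 / real (Suc m))\<bar>) \<longlonglongrightarrow> c * \<bar>grad f x \<bullet> v\<bar>"
    by (intro tendsto_mult_left tendsto_rabs tendsto_dquot_grad f)
  moreover have "\<bar>dquot g v x h\<bar> \<le> c * \<bar>dquot f v x h\<bar>" for h
    using le[of "x + h *\<^sub>R v"] by (simp add: dquot_def abs_divide divide_right_mono)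
  ultimately have "\<bar>grad g x \<bullet> v\<bar> \<le> c * \<bar>grad f x \<bullet> v\<bar>"
    by (intro LIMSEQ_le) auto
  also have "\<dots> \<le> c * (norm (grad f x) * norm v)"
    using c by (intro mult_left_mono Cauchy_Schwarz_ineq2)
  finally have "norm (grad g x) * norm (grad g x) \<le> c * norm (grad f x) * norm (grad g x)"
    by (simp add: v_def dot_square_norm power2_eq_square mult.assoc)
  then show ?thesis
    using c by (cases "norm (grad g x) = 0") auto
qed

lemma locally_lipschitz_continuous:
  assumes "locally_lipschitz f"
  shows "continuous_on UNIV f"
proof -
  have "isCont f x" for x
  proof -
    obtain e L where "e > 0" "L-lipschitz_on (ball x e) f"
      using assms unfolding locally_lipschitz_def by blast
    then show ?thesis
      using lipschitz_on_continuous_on[of L "ball x e" f] by (auto simp: continuous_on_eq_continuous_at)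
  qed
  then show ?thesis by (simp add: continuous_at_imp_continuous_on)
qed

lemma AE_differentiable_locally_lipschitz:
  assumes "locally_lipschitz f"
  shows "AE x in lebesgue. f differentiable (at x)"
  using assms by (intro AE_completion Rademacher) (simp add: locally_lipschitz_def)

text \<open>Off a null set each component is a limit of continuous difference quotients;
  completeness of the Lebesgue measure absorbs the exceptional set.\<close>

lemma borel_measurable_grad:
  assumes f: "locally_lipschitz f"
  shows "grad f \<in> borel_measurable lebesgue"
proof (rule borel_measurable_euclidean_space[THEN iffD2], rule ballI)
  fix v :: "real ^ 'a" assume "v \<in> Basis"
  have cont: "continuous_on UNIV f" using f by (rule locally_lipschitz_continuous)
  have "continuous_on UNIV (\<lambda>x. dquot f v x h)" for h
    unfolding dquot_def divide_inverse
    by (intro continuous_intros continuous_on_compose2[OF cont]) auto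
  then have [measurable]: "(\<lambda>x. dquot f v x h) \<in> borel_measurable lebesgue" for h
    by (intro measurable_completion) (simp add: borel_measurable_continuous_onI)
  have "(\<lambda>x. lim (\<lambda>m. dquot f v x (1 / real (Suc m)))) \<in> borel_measurable lebesgue"
    by measurable
  then show "(\<lambda>x. grad f x \<bullet> v) \<in> borel_measurable lebesgue"
  proof (rule borel_measurable_AE)
    show "AE x in lebesgue. lim (\<lambda>m. dquot f v x (1 / real (Suc m))) = grad f x \<bullet> v"
      using AE_differentiable_locally_lipschitz[OF f]
      by eventually_elim (rule limI tendsto_dquot_grad, assumption?)+
  qed
qed

section \<open>Oscillation on a ball and the gradient\<close>

lemma nn_integral_translate_le_grad:
  fixes F :: "real ^ 'n \<Rightarrow> real"
  assumes lip: "L-lipschitz_on UNIV F" and v: "norm v \<le> \<rho>"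
  shows "(\<integral>\<^sup>+x. indicator (cball 0 R) x * ennreal \<bar>F (x + v) - F x\<bar> \<partial>lborel)
    \<le> ennreal \<rho> * (\<integral>\<^sup>+x. indicator (cball 0 (R + \<rho>)) x * ennreal (norm (grad F x)) \<partial>lborel)"
    (is "?I \<le> _")
proof -
  let ?B = "cball (0 :: real ^ 'n) (R + \<rho>)"
  have cont: "continuous_on UNIV F" using lip by (rule lipschitz_on_continuous_on)
  have [measurable]: "F \<in> borel_measurable borel" using cont by (rule borel_measurable_continuous_onI)
  have ll: "locally_lipschitz F"
    using lip unfolding locally_lipschitz_def
    by (intro allI exI[of _ 1] conjI exI[of _ L]) (auto intro: lipschitz_on_subset)
  have [measurable]: "?B \<in> sets borel" by simp
  define u where "u m x = indicator ?B x * ennreal \<bar>dquot F v x (1 / real (Suc m))\<bar>" for m x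
  have u_meas[measurable]: "u m \<in> borel_measurable borel" for m
    unfolding u_def dquot_def by measurable
  \<comment> \<open>Cut the shift by \<open>v\<close> into \<open>m + 1\<close> equal shifts and use translation invariance; the limit
    \<open>m \<longlonglongrightarrow> \<infinity>\<close> then brings in the gradient without integrating along segments.\<close>
  have le: "?I \<le> (\<integral>\<^sup>+x. u m x \<partial>lborel)" for m
  proof -
    define M where "M = Suc m"
    define p where "p k = (real k / real M) *\<^sub>R v" for k
    define w where "w x = indicator ?B x * ennreal \<bar>F (x + p 1) - F x\<bar>" for x
    have [measurable]: "w \<in> borel_measurable borel" unfolding w_def by measurable
    have pS: "x + p (Suc k) = x + p k + p 1" for k x
      by (simp add: p_def add_divide_distrib scaleR_left_distrib)
    have pn: "norm (p k) \<le> \<rho>" if "k \<le> M" for k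
    proof -
      have "norm (p k) = real k / real M * norm v" by (simp add: p_def)
      also have "\<dots> \<le> 1 * norm v" using that by (intro mult_right_mono) (auto simp: M_def)
      finally show ?thesis using v by simp
    qed
    have "indicator (cball 0 R) x * ennreal \<bar>F (x + v) - F x\<bar> \<le> (\<Sum>k<M. w (x + p k))" for x
    proof (cases "x \<in> cball 0 R")
      case True
      have "F (x + v) - F x = F (x + p M) - F (x + p 0)" by (simp add: p_def M_def)
      also have "\<dots> = (\<Sum>k<M. F (x + p (Suc k)) - F (x + p k))"
        by (rule sum_lessThan_telescope[symmetric])
      finally have "\<bar>F (x + v) - F x\<bar> \<le> (\<Sum>k<M. \<bar>F (x + p k + p 1) - F (x + p k)\<bar>)"
        by (simp only: pS sum_abs)
      then have "ennreal \<bar>F (x + v) - F x\<bar> \<le> (\<Sum>k<M. ennreal \<bar>F (x + p k + p 1) - F (x + p k)\<bar>)"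
        by (simp add: ennreal_leI)
      also have "\<dots> = (\<Sum>k<M. w (x + p k))"
      proof (rule sum.cong)
        fix k assume "k \<in> {..<M}"
        then have "norm (x + p k) \<le> R + \<rho>"
          using True pn[of k] norm_triangle_ineq[of x "p k"] by simp
        then show "ennreal \<bar>F (x + p k + p 1) - F (x + p k)\<bar> = w (x + p k)" by (simp add: w_def)
      qed simp
      finally show ?thesis using True by simp
    qed simp
    then have "?I \<le> (\<integral>\<^sup>+x. (\<Sum>k<M. w (x + p k)) \<partial>lborel)" by (intro nn_integral_mono)
    also have "\<dots> = (\<Sum>k<M. \<integral>\<^sup>+x. w (x + p k) \<partial>lborel)"
      by (rule nn_integral_sum) measurable
    also have "\<dots> = of_nat M * (\<integral>\<^sup>+x. w x \<partial>lborel)"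
      by (simp add: nn_integral_lborel_translation)
    also have "\<dots> = (\<integral>\<^sup>+x. of_nat M * w x \<partial>lborel)"
      by (rule nn_integral_cmult[symmetric]) measurable
    also have "\<dots> = (\<integral>\<^sup>+x. u m x \<partial>lborel)"
    proof (rule nn_integral_cong)
      fix x
      have "of_nat M * ennreal \<bar>F (x + p 1) - F x\<bar> = ennreal (real M * \<bar>F (x + p 1) - F x\<bar>)"
        by (simp add: ennreal_mult ennreal_of_nat_eq_real_of_nat)
      also have "real M * \<bar>F (x + p 1) - F x\<bar> = \<bar>dquot F v x (1 / real (Suc m))\<bar>"
        by (simp add: dquot_def p_def M_def abs_mult)
      finally show "of_nat M * w x = u m x"
        unfolding w_def u_def by (cases "x \<in> ?B") simp_all
    qed
    finally show ?thesis .
  qed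
  have "(\<lambda>m. \<integral>\<^sup>+x. u m x \<partial>lebesgue) \<longlonglongrightarrow> (\<integral>\<^sup>+x. indicator ?B x * ennreal \<bar>grad F x \<bullet> v\<bar> \<partial>lebesgue)"
  proof (rule nn_integral_dominated_convergence)
    show "u m \<in> borel_measurable lebesgue" for m by (rule measurable_completion) simp
    have [measurable]: "grad F \<in> borel_measurable lebesgue" by (rule borel_measurable_grad[OF ll])
    have [measurable]: "?B \<in> sets lebesgue" by simp
    show "(\<lambda>x. indicator ?B x * ennreal \<bar>grad F x \<bullet> v\<bar>) \<in> borel_measurable lebesgue" by measurable
    show "(\<lambda>x. ennreal (L * norm v) * indicator ?B x) \<in> borel_measurable lebesgue" by measurable
    show "AE x in lebesgue. u m x \<le> ennreal (L * norm v) * indicator ?B x" for m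
      using abs_dquot_le[OF lip] by (intro AE_I2) (auto simp: u_def indicator_def ennreal_leI)
    have "emeasure lborel ?B < \<infinity>" by (rule emeasure_bounded_finite) simp
    then show "(\<integral>\<^sup>+x. ennreal (L * norm v) * indicator ?B x \<partial>lebesgue) < \<infinity>"
      by (simp add: nn_integral_cmult_indicator ennreal_mult_less_top)
    show "AE x in lebesgue. (\<lambda>m. u m x) \<longlonglongrightarrow> indicator ?B x * ennreal \<bar>grad F x \<bullet> v\<bar>"
      using AE_differentiable_locally_lipschitz[OF ll]
    proof eventually_elim
      case (elim x)
      have "(\<lambda>m. ennreal \<bar>dquot F v x (1 / real (Suc m))\<bar>) \<longlonglongrightarrow> ennreal \<bar>grad F x \<bullet> v\<bar>"
        by (intro tendsto_ennrealI tendsto_rabs tendsto_dquot_grad elim)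
      then show ?case by (cases "x \<in> ?B") (simp_all add: u_def)
    qed
  qed
  then have "?I \<le> (\<integral>\<^sup>+x. indicator ?B x * ennreal \<bar>grad F x \<bullet> v\<bar> \<partial>lborel)"
    unfolding nn_integral_completion by (rule LIMSEQ_le_const) (use le in auto)
  \<comment> \<open>\<open>grad F\<close> is only known to be Lebesgue measurable. Nonnegative
    integrals over \<open>lborel\<close> and \<open>lebesgue\<close> agree for every function, but
    pulling out the factor \<rho> asks for measurability, hence the change of measure.\<close>
  also have "\<dots> = (\<integral>\<^sup>+x. indicator ?B x * ennreal \<bar>grad F x \<bullet> v\<bar> \<partial>lebesgue)"
    by (rule nn_integral_completion[symmetric])
  also have "\<dots> \<le> (\<integral>\<^sup>+x. ennreal \<rho> * (indicator ?B x * ennreal (norm (grad F x))) \<partial>lebesgue)"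
  proof (rule nn_integral_mono)
    fix x
    have \<rho>: "0 \<le> \<rho>" using v norm_ge_zero[of v] by linarith
    have "\<bar>grad F x \<bullet> v\<bar> \<le> norm (grad F x) * norm v" by (rule Cauchy_Schwarz_ineq2)
    also have "\<dots> \<le> \<rho> * norm (grad F x)"
      using v by (subst mult.commute) (intro mult_right_mono, auto)
    finally have "ennreal \<bar>grad F x \<bullet> v\<bar> \<le> ennreal \<rho> * ennreal (norm (grad F x))"
      using \<rho> by (simp add: ennreal_mult[symmetric] ennreal_leI)
    then show "indicator ?B x * ennreal \<bar>grad F x \<bullet> v\<bar> \<le> ennreal \<rho> * (indicator ?B x * ennreal (norm (grad F x)))"
      by (simp add: indicator_def)
  qed
  also have "\<dots> = ennreal \<rho> * (\<integral>\<^sup>+x. indicator ?B x * ennreal (norm (grad F x)) \<partial>lebesgue)"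
  proof (rule nn_integral_cmult)
    have [measurable]: "grad F \<in> borel_measurable lebesgue" by (rule borel_measurable_grad[OF ll])
    have [measurable]: "?B \<in> sets lebesgue" by simp
    show "(\<lambda>x. indicator ?B x * ennreal (norm (grad F x))) \<in> borel_measurable lebesgue" by measurable
  qed
  finally show ?thesis unfolding nn_integral_completion .
qed

text \<open>A crude L^1 Poincare inequality. With x = y + v the shift v ranges over the ball of
  radius 2 R. After exchanging the integrals each v contributes at most 2 R times the gradient
  integral over the ball of radius R + 2 R, and integrating over v produces the volume
  factor.\<close>

lemma nn_integral_ball_oscillation_le:
  fixes f :: "real ^ 'n \<Rightarrow> real"
  assumes f: "locally_lipschitz f" and R: "0 \<le> R"
  defines "B \<equiv> cball (0 :: real ^ 'n) R"
  shows "(\<integral>\<^sup>+y. indicator B y * (\<integral>\<^sup>+x. indicator B x * ennreal \<bar>f x - f y\<bar> \<partial>lborel) \<partial>lborel)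
    \<le> emeasure lborel (cball (0 :: real ^ 'n) (2 * R)) * ennreal (2 * R) *
      (\<integral>\<^sup>+x. indicator (cball 0 (3 * R)) x * ennreal (norm (grad f x)) \<partial>lborel)" (is "?I \<le> ?V * _ * ?G")
proof -
  have "\<And>x. \<exists>e>0. \<exists>L. L-lipschitz_on (ball x e) f" using f by (simp add: locally_lipschitz_def)
  \<comment> \<open>The margin 1 makes F agree with f near every point of the closed ball of radius
    3 R, so the gradients agree on its boundary as well.\<close>
  then obtain F L where lip: "L-lipschitz_on UNIV F" and F: "\<And>x. norm x \<le> 3 * R + 1 \<Longrightarrow> F x = f x"
    using lipschitz_extension_of_local[of f "3 * R + 1"] by metis
  have [measurable]: "F \<in> borel_measurable borel"
    using lipschitz_on_continuous_on[OF lip] by (rule borel_measurable_continuous_onI)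
  have [measurable]: "B \<in> sets borel" "cball (0 :: real ^ 'n) (2 * R) \<in> sets borel"
    by (simp_all add: B_def)
  have G: "(\<integral>\<^sup>+x. indicator (cball 0 (R + 2 * R)) x * ennreal (norm (grad F x)) \<partial>lborel) = ?G"
  proof (rule nn_integral_cong)
    fix x :: "real ^ 'n"
    have "grad F x = grad f x" if "norm x \<le> 3 * R"
      by (rule grad_eq_of_eq_near[of "ball 0 (3 * R + 1)"]) (use that F in auto)
    then show "indicator (cball 0 (R + 2 * R)) x * ennreal (norm (grad F x)) =
      indicator (cball 0 (3 * R)) x * ennreal (norm (grad f x))"
      by (auto simp: indicator_def)
  qed
  have "?I = (\<integral>\<^sup>+y. (\<integral>\<^sup>+x. indicator B y * (indicator B x * ennreal \<bar>F x - F y\<bar>) \<partial>lborel) \<partial>lborel)"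
  proof (rule nn_integral_cong)
    fix y :: "real ^ 'n"
    have "(\<integral>\<^sup>+x. indicator B y * (indicator B x * ennreal \<bar>F x - F y\<bar>) \<partial>lborel)
        = indicator B y * (\<integral>\<^sup>+x. indicator B x * ennreal \<bar>F x - F y\<bar> \<partial>lborel)"
      by (rule nn_integral_cmult) measurable
    also have "\<dots> = indicator B y * (\<integral>\<^sup>+x. indicator B x * ennreal \<bar>f x - f y\<bar> \<partial>lborel)"
    proof (cases "y \<in> B")
      case True
      have "indicator B x * ennreal \<bar>F x - F y\<bar> = indicator B x * ennreal \<bar>f x - f y\<bar>" for x
        using True F[of x] F[of y] R by (cases "x \<in> B") (auto simp: B_def)
      then show ?thesis by simp
    qed simp
    finally show "indicator B y * (\<integral>\<^sup>+x. indicator B x * ennreal \<bar>f x - f y\<bar> \<partial>lborel) =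
      (\<integral>\<^sup>+x. indicator B y * (indicator B x * ennreal \<bar>F x - F y\<bar>) \<partial>lborel)" ..
  qed
  also have "\<dots> \<le> (\<integral>\<^sup>+y. (\<integral>\<^sup>+v. indicator (cball 0 (2 * R)) v * (indicator B y * ennreal \<bar>F (y + v) - F y\<bar>) \<partial>lborel) \<partial>lborel)"
  proof (rule nn_integral_mono)
    fix y :: "real ^ 'n"
    have "(\<integral>\<^sup>+x. indicator B y * (indicator B x * ennreal \<bar>F x - F y\<bar>) \<partial>lborel) =
      (\<integral>\<^sup>+v. indicator B y * (indicator B (v + y) * ennreal \<bar>F (v + y) - F y\<bar>) \<partial>lborel)"
      by (rule nn_integral_lborel_translation[symmetric]) measurable
    also have "\<dots> \<le> (\<integral>\<^sup>+v. indicator (cball 0 (2 * R)) v * (indicator B y * ennreal \<bar>F (y + v) - F y\<bar>) \<partial>lborel)"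
    proof (rule nn_integral_mono)
      fix v
      have "norm v \<le> 2 * R" if "norm y \<le> R" "norm (v + y) \<le> R"
        using that norm_triangle_ineq4[of "v + y" y] by simp
      then show "indicator B y * (indicator B (v + y) * ennreal \<bar>F (v + y) - F y\<bar>)
        \<le> indicator (cball 0 (2 * R)) v * (indicator B y * ennreal \<bar>F (y + v) - F y\<bar>)"
        by (auto simp: indicator_def B_def add.commute)
    qed
    finally show "(\<integral>\<^sup>+x. indicator B y * (indicator B x * ennreal \<bar>F x - F y\<bar>) \<partial>lborel) \<le>
      (\<integral>\<^sup>+v. indicator (cball 0 (2 * R)) v * (indicator B y * ennreal \<bar>F (y + v) - F y\<bar>) \<partial>lborel)" .
  qed
  also have "\<dots> = (\<integral>\<^sup>+v. (\<integral>\<^sup>+y. indicator (cball 0 (2 * R)) v * (indicator B y * ennreal \<bar>F (y + v) - F y\<bar>) \<partial>lborel) \<partial>lborel)"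
    by (rule lborel_pair.Fubini') measurable
  also have "\<dots> \<le> (\<integral>\<^sup>+v. (ennreal (2 * R) * ?G) * indicator (cball (0 :: real ^ 'n) (2 * R)) v \<partial>lborel)"
  proof (rule nn_integral_mono)
    fix v :: "real ^ 'n"
    have "(\<integral>\<^sup>+y. indicator (cball 0 (2 * R)) v * (indicator B y * ennreal \<bar>F (y + v) - F y\<bar>) \<partial>lborel)
      = indicator (cball 0 (2 * R)) v * (\<integral>\<^sup>+y. indicator B y * ennreal \<bar>F (y + v) - F y\<bar> \<partial>lborel)"
      by (rule nn_integral_cmult) measurable
    also have "\<dots> \<le> indicator (cball 0 (2 * R)) v * (ennreal (2 * R) * ?G)"
      using nn_integral_translate_le_grad[OF lip, of v "2 * R" R] unfolding B_def G
      by (cases "v \<in> cball 0 (2 * R)") auto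
    finally show "(\<integral>\<^sup>+y. indicator (cball 0 (2 * R)) v * (indicator B y * ennreal \<bar>F (y + v) - F y\<bar>) \<partial>lborel)
      \<le> (ennreal (2 * R) * ?G) * indicator (cball 0 (2 * R)) v" by (simp add: mult.commute)
  qed
  also have "\<dots> = (ennreal (2 * R) * ?G) * ?V" by (rule nn_integral_cmult_indicator) simp
  finally show ?thesis by (simp add: mult_ac)
qed

section \<open>Lower bounds for the energy under the probability measure\<close>

locale gibbs =
  fixes V :: "real ^ 'n \<Rightarrow> real"
  assumes continuous_V: "continuous_on UNIV V"
    and integrable_exp: "integrable lborel (\<lambda>x. exp (- V x))"
begin

definition w :: "real ^ 'n \<Rightarrow> real" where
  "w x = exp (- V x) / Zc V"

lemma continuous_exp_V: "continuous_on UNIV (\<lambda>x. exp (- V x))"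
  by (intro continuous_intros continuous_V)

lemma Zc_pos: "0 < Zc V"
proof -
  have "\<not> (AE x in lborel :: (real ^ 'n) measure. exp (- V x) = 0)"
    by (simp add: ae_filter_eq_bot_iff flip: trivial_limit_def)
  then have "Zc V \<noteq> 0"
    unfolding Zc_def using integral_nonneg_eq_0_iff_AE[OF integrable_exp] by auto
  moreover have "0 \<le> Zc V" unfolding Zc_def by (rule Bochner_Integration.integral_nonneg) simp
  ultimately show ?thesis by simp
qed

lemma w_pos: "0 < w x"
  using Zc_pos by (simp add: w_def)

lemma continuous_w: "continuous_on UNIV w"
  unfolding w_def using Zc_pos by (intro continuous_intros continuous_exp_V) auto

lemma measurable_w [measurable]: "w \<in> borel_measurable borel"
  by (rule borel_measurable_continuous_onI[OF continuous_w])

lemma measurable_w_lebesgue [measurable]: "w \<in> borel_measurable lebesgue"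
  by (rule measurable_completion) simp

lemma mu_eq: "mu V = density lebesgue (\<lambda>x. ennreal (w x))"
  by (simp add: mu_def w_def)

lemma sets_mu [simp, measurable_cong]: "sets (mu V) = sets lebesgue"
  by (simp add: mu_eq)

lemma space_mu [simp]: "space (mu V) = UNIV"
  by (simp add: mu_eq)

lemma nn_integral_mu:
  assumes "u \<in> borel_measurable lebesgue"
  shows "(\<integral>\<^sup>+x. u x \<partial>mu V) = (\<integral>\<^sup>+x. ennreal (w x) * u x \<partial>lborel)"
  unfolding mu_eq using assms by (subst nn_integral_density) (auto simp: nn_integral_completion)

lemma emeasure_mu_UNIV: "emeasure (mu V) UNIV = 1"
proof -
  have "emeasure (mu V) UNIV = (\<integral>\<^sup>+x. 1 \<partial>mu V)" by simp
  also have "\<dots> = (\<integral>\<^sup>+x. ennreal (w x) \<partial>lborel)" by (subst nn_integral_mu) simp_all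
  also have "\<dots> = ennreal (\<integral>x. w x \<partial>lborel)"
    using w_pos integrable_exp by (intro nn_integral_eq_integral) (auto simp: w_def less_imp_le)
  also have "(\<integral>x. w x \<partial>lborel) = 1"
    using Zc_pos by (simp add: w_def flip: Zc_def)
  finally show ?thesis by simp
qed

sublocale M: finite_measure "mu V"
  by (rule finite_measureI) (simp add: emeasure_mu_UNIV)

lemma measure_mu_UNIV: "measure (mu V) UNIV = 1"
  by (simp add: measure_def emeasure_mu_UNIV)

lemma measure_mu_le_1: "measure (mu V) A \<le> 1"
  using M.bounded_measure[of A] by (simp add: measure_mu_UNIV)

lemma AE_mu:
  assumes "AE x in lebesgue. P x"
  shows "AE x in mu V. P x"
  unfolding mu_eq using assms by (subst AE_density) auto

lemma measurable_locally_lipschitz: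
  fixes f :: "real ^ 'n \<Rightarrow> real"
  assumes "locally_lipschitz f"
  shows "f \<in> borel_measurable lebesgue"
  using locally_lipschitz_continuous[OF assms]
  by (intro measurable_completion) (simp add: borel_measurable_continuous_onI)

lemma exists_ball_large:
  assumes "0 < \<delta>"
  obtains R where "0 < R" "1 - \<delta> < measure (mu V) (cball 0 R)"
proof -
  have "(\<lambda>n. measure (mu V) (cball 0 (real n))) \<longlonglongrightarrow> measure (mu V) (\<Union>n. cball 0 (real n))"
    by (rule M.finite_Lim_measure_incseq) (auto simp: incseq_def)
  also have "(\<Union>n. cball 0 (real n)) = (UNIV :: (real ^ 'n) set)"
    by (auto simp: real_arch_simple)
  finally have "(\<lambda>n. measure (mu V) (cball 0 (real n))) \<longlonglongrightarrow> 1" by (simp add: measure_mu_UNIV)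
  then have "\<forall>\<^sub>F n in sequentially. 1 - \<delta> < measure (mu V) (cball 0 (real n))"
    using assms by (intro order_tendstoD) auto
  then have "\<forall>\<^sub>F n in sequentially. 0 < real n \<and> 1 - \<delta> < measure (mu V) (cball 0 (real n))"
    using eventually_gt_at_top[of 0] by eventually_elim simp
  then obtain n where "0 < real n \<and> 1 - \<delta> < measure (mu V) (cball 0 (real n))"
    by (auto simp: eventually_sequentially)
  then show thesis using that by blast
qed

lemma w_bounds:
  obtains m M where "0 < m" "0 < M" "\<And>x. norm x \<le> R \<Longrightarrow> m \<le> w x \<and> w x \<le> M"
proof (cases "0 \<le> R")
  case True
  have ne: "cball (0 :: real ^ 'n) R \<noteq> {}" using True by simp
  have c: "continuous_on (cball 0 R) w" using continuous_w by (rule continuous_on_subset) simp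
  obtain a where a: "\<And>x. norm x \<le> R \<Longrightarrow> w a \<le> w x"
    using continuous_attains_inf[OF compact_cball ne c] by (metis mem_cball_0)
  obtain b where b: "\<And>x. norm x \<le> R \<Longrightarrow> w x \<le> w b"
    using continuous_attains_sup[OF compact_cball ne c] by (metis mem_cball_0)
  then show thesis using that[of "w a" "w b"] w_pos a b by blast
next
  case False
  then have "\<not> norm x \<le> R" for x :: "real ^ 'n" using norm_ge_zero[of x] by linarith
  then show thesis using that[of 1 1] by simp
qed

lemma integrable_norm_grad:
  assumes "admissible V f"
  shows "integrable (mu V) (\<lambda>x. norm (grad f x))"
proof (rule Bochner_Integration.integrable_bound)
  have ll: "locally_lipschitz f" using assms by (simp add: admissible_def)
  show "integrable (mu V) (\<lambda>x. 1 + (norm (grad f x))\<^sup>2)"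
    using assms by (auto simp: admissible_def)
  have [measurable]: "grad f \<in> borel_measurable lebesgue" by (rule borel_measurable_grad[OF ll])
  show "(\<lambda>x. norm (grad f x)) \<in> borel_measurable (mu V)" by measurable
  show "AE x in mu V. norm (norm (grad f x)) \<le> norm (1 + (norm (grad f x))\<^sup>2)"
  proof (rule AE_I2)
    fix x
    have "2 * norm (grad f x) \<le> 1 + (norm (grad f x))\<^sup>2"
      using zero_le_power2[of "norm (grad f x) - 1"] by (simp add: power2_diff)
    then have "norm (grad f x) \<le> 1 + (norm (grad f x))\<^sup>2" using norm_ge_zero[of "grad f x"] by linarith
    then show "norm (norm (grad f x)) \<le> norm (1 + (norm (grad f x))\<^sup>2)" by simp
  qed
qed

text \<open>Jensen's inequality, obtained by integrating 2 s y \<le> y^2 + s^2 against a probability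
  measure.\<close>

lemma energy_ge_square:
  assumes "admissible V f" and s: "0 \<le> s" "s \<le> (\<integral>x. norm (grad f x) \<partial>mu V)"
  shows "s\<^sup>2 \<le> energy V f"
proof -
  have i: "integrable (mu V) (\<lambda>x. (norm (grad f x))\<^sup>2)" using assms(1) by (simp add: admissible_def)
  note j = integrable_norm_grad[OF assms(1)]
  have "2 * s * (\<integral>x. norm (grad f x) \<partial>mu V) = (\<integral>x. 2 * s * norm (grad f x) \<partial>mu V)" by simp
  also have "\<dots> \<le> (\<integral>x. (norm (grad f x))\<^sup>2 + s\<^sup>2 \<partial>mu V)"
  proof (rule integral_mono)
    show "2 * s * norm (grad f x) \<le> (norm (grad f x))\<^sup>2 + s\<^sup>2" for x
      using zero_le_power2[of "norm (grad f x) - s"] by (simp add: power2_diff mult_ac)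
  qed (use i j in auto)
  also have "\<dots> = energy V f + s\<^sup>2"
    using i by (simp add: energy_def measure_mu_UNIV)
  finally have "2 * s * (\<integral>x. norm (grad f x) \<partial>mu V) \<le> energy V f + s\<^sup>2" .
  moreover have "2 * s * s \<le> 2 * s * (\<integral>x. norm (grad f x) \<partial>mu V)"
    using s by (intro mult_left_mono) auto
  ultimately show ?thesis by (simp add: power2_eq_square)
qed

text \<open>For y in the zero set S of f within a large ball \<open>B\<close> the difference |f x -
  f y| is f x, so the oscillation integral is at least the volume of S times the integral of f over
  \<open>B\<close>. Both factors are bounded below, hence so are the L^1 norm of the gradient and
  the energy.\<close>

lemma energy_bounded_below:
  assumes "0 < c"
  obtains e where "0 < e" "\<And>f. admissible V f \<Longrightarrow> (\<And>x. 0 \<le> f x \<and> f x \<le> 1) \<Longrightarrow>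
    measure (mu V) {x. f x \<noteq> 0} \<le> 1/2 \<Longrightarrow> c \<le> (\<integral>x. (f x)\<^sup>2 \<partial>mu V) \<Longrightarrow> e \<le> energy V f"
proof -
  \<comment> \<open>The entry c/2 leaves at least c/2 of the integral of f on the ball; the entry
    1/4 leaves mass at least 1 - 1/2 - 1/4 for the zero set of f inside it.\<close>
  define \<delta> where "\<delta> = min (c/2) (1/4)"
  have "0 < \<delta>" using assms by (simp add: \<delta>_def)
  then obtain R where R: "0 < R" "1 - \<delta> < measure (mu V) (cball 0 R)"
    using exists_ball_large by blast
  define B where "B = cball (0 :: real ^ 'n) R"
  have B[measurable]: "B \<in> sets borel" by (simp add: B_def)
  then have [measurable]: "B \<in> sets lebesgue" by simp
  obtain m M where mM: "0 < m" "0 < M" "\<And>x. norm x \<le> 3 * R \<Longrightarrow> m \<le> w x \<and> w x \<le> M"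
    using w_bounds by metis
  define k where "k = measure lborel (cball (0 :: real ^ 'n) (2 * R)) * (2 * R)"
  have k: "emeasure lborel (cball (0 :: real ^ 'n) (2 * R)) * ennreal (2 * R) = ennreal k" "0 \<le> k"
    using R emeasure_bounded_finite[of "cball (0 :: real ^ 'n) (2 * R)"]
    by (auto simp: k_def emeasure_eq_ennreal_measure ennreal_mult)
  \<comment> \<open>Solves m (1/4) (c/2) \<le> M^2 k I for the L^1 norm I of the gradient; k + 1
    replaces k to have a positive divisor.\<close>
  define s where "s = c * m / (8 * (M\<^sup>2 * (k + 1)))"
  have s: "0 < s" using assms mM k by (simp add: s_def)
  have main: "s\<^sup>2 \<le> energy V f"
    if adm: "admissible V f" and f01: "\<And>x. 0 \<le> f x \<and> f x \<le> 1"
      and half: "measure (mu V) {x. f x \<noteq> 0} \<le> 1/2" and big: "c \<le> (\<integral>x. (f x)\<^sup>2 \<partial>mu V)" for f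
  proof -
    have ll: "locally_lipschitz f" using adm by (simp add: admissible_def)
    have fb[measurable]: "f \<in> borel_measurable borel"
      by (rule borel_measurable_continuous_onI[OF locally_lipschitz_continuous[OF ll]])
    have fl[measurable]: "f \<in> borel_measurable lebesgue" by (rule measurable_locally_lipschitz[OF ll])
    have gl[measurable]: "grad f \<in> borel_measurable lebesgue" by (rule borel_measurable_grad[OF ll])
    have C3l[measurable]: "cball (0 :: real ^ 'n) (3 * R) \<in> sets lebesgue" by simp
    define S where "S = {y. f y = 0} \<inter> B"
    have S[measurable]: "S \<in> sets borel" unfolding S_def by measurable
    then have Sl[measurable]: "S \<in> sets lebesgue" by simp
    have Bc: "measure (mu V) (- B) \<le> \<delta>"
      using M.finite_measure_compl[of B] R by (simp add: measure_mu_UNIV B_def Compl_eq_Diff_UNIV)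
    have S4: "1/4 \<le> measure (mu V) S"
    proof -
      have "{x \<in> space lebesgue. f x \<noteq> 0} \<in> sets lebesgue" by measurable
      then have [measurable]: "{x. f x \<noteq> 0} \<in> sets lebesgue" by simp
      have "1 = measure (mu V) (S \<union> ({x. f x \<noteq> 0} \<union> - B))"
        unfolding measure_mu_UNIV[symmetric] by (rule arg_cong[where f="measure (mu V)"]) (auto simp: S_def)
      also have "\<dots> \<le> measure (mu V) S + measure (mu V) ({x. f x \<noteq> 0} \<union> - B)"
        by (intro measure_Un_le) auto
      also have "\<dots> \<le> measure (mu V) S + (measure (mu V) {x. f x \<noteq> 0} + measure (mu V) (- B))"
        by (intro add_left_mono measure_Un_le) auto
      finally show ?thesis using half Bc by (simp add: \<delta>_def)
    qed
    \<comment> \<open>The oscillation estimate concerns Lebesgue measure. The upper density bound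
      \<open>M\<close> carries over the lower bounds for S and for the integral of f; the lower
      density bound \<open>m\<close> carries the gradient integral back to
      \<open>mu V\<close>.\<close>
    have "ennreal (1/4) \<le> emeasure (mu V) S"
      using S4 by (simp add: M.emeasure_eq_measure)
    also have "\<dots> = (\<integral>\<^sup>+x. ennreal (w x) * indicator S x \<partial>lborel)"
      by (subst nn_integral_mu[symmetric]) simp_all
    also have "\<dots> \<le> (\<integral>\<^sup>+x. ennreal M * indicator S x \<partial>lborel)"
      using mM(3) R by (intro nn_integral_mono) (auto simp: indicator_def S_def B_def intro!: ennreal_leI)
    also have "\<dots> = ennreal M * emeasure lborel S" by (rule nn_integral_cmult_indicator) simp
    finally have e1: "ennreal (1/4) \<le> ennreal M * emeasure lborel S" .
    define a where "a = (\<integral>\<^sup>+x. indicator B x * ennreal (f x) \<partial>lborel)"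
    have fi: "integrable (mu V) f"
      by (rule M.integrable_const_bound[of _ 1]) (use f01 in auto)
    have iB: "integrable (mu V) (\<lambda>x. indicator B x * f x)"
      using integrable_mult_indicator[of B "mu V" f] fi by simp
    have iBc: "integrable (mu V) (indicator (- B) :: _ \<Rightarrow> real)"
      by (rule integrable_real_indicator) (simp_all add: M.emeasure_eq_measure)
    have "c - \<delta> \<le> (\<integral>x. indicator B x * f x \<partial>mu V)"
    proof -
      have "c \<le> (\<integral>x. (f x)\<^sup>2 \<partial>mu V)" by (rule big)
      also have "\<dots> \<le> (\<integral>x. indicator B x * f x + indicator (- B) x \<partial>mu V)"
      proof (rule integral_mono)
        show "integrable (mu V) (\<lambda>x. (f x)\<^sup>2)" using adm by (simp add: admissible_def)
        show "integrable (mu V) (\<lambda>x. indicator B x * f x + indicator (- B) x)"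
          by (intro Bochner_Integration.integrable_add iB iBc)
        fix x
        have "(f x)\<^sup>2 \<le> f x" using f01[of x] by (simp add: power2_eq_square mult_left_le)
        then show "(f x)\<^sup>2 \<le> indicator B x * f x + indicator (- B) x"
          using f01[of x] by (auto simp: indicator_def)
      qed
      also have "\<dots> = (\<integral>x. indicator B x * f x \<partial>mu V) + measure (mu V) (- B)"
        by (subst Bochner_Integration.integral_add[OF iB iBc]) simp
      finally show ?thesis using Bc by simp
    qed
    then have "ennreal (c/2) \<le> ennreal (\<integral>x. indicator B x * f x \<partial>mu V)"
      by (intro ennreal_leI) (simp add: \<delta>_def)
    also have "\<dots> = (\<integral>\<^sup>+x. ennreal (indicator B x * f x) \<partial>mu V)"
      using iB f01 by (intro nn_integral_eq_integral[symmetric]) auto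
    also have "\<dots> = (\<integral>\<^sup>+x. ennreal (w x) * ennreal (indicator B x * f x) \<partial>lborel)"
      by (rule nn_integral_mu) measurable
    also have "\<dots> \<le> (\<integral>\<^sup>+x. ennreal M * (indicator B x * ennreal (f x)) \<partial>lborel)"
      using mM(3) R by (intro nn_integral_mono) (auto simp: indicator_def B_def intro!: mult_right_mono ennreal_leI)
    also have "\<dots> = ennreal M * a" unfolding a_def by (rule nn_integral_cmult) measurable
    finally have e2: "ennreal (c/2) \<le> ennreal M * a" .
    define J where "J = (\<integral>\<^sup>+y. indicator B y * (\<integral>\<^sup>+x. indicator B x * ennreal \<bar>f x - f y\<bar> \<partial>lborel) \<partial>lborel)"
    define G where "G = (\<integral>\<^sup>+x. indicator (cball 0 (3 * R)) x * ennreal (norm (grad f x)) \<partial>lborel)"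
    have "emeasure lborel S * a = (\<integral>\<^sup>+y. a * indicator S y \<partial>lborel)"
      by (subst nn_integral_cmult_indicator) (simp_all add: mult.commute)
    also have "\<dots> \<le> J"
      unfolding J_def using f01
      by (intro nn_integral_mono) (auto simp: indicator_def S_def a_def intro!: nn_integral_mono)
    also have "J \<le> ennreal k * G"
      unfolding J_def G_def B_def k(1)[symmetric] by (rule nn_integral_ball_oscillation_le[OF ll]) (use R in simp)
    finally have e3: "emeasure lborel S * a \<le> ennreal k * G" .
    have "G = (\<integral>\<^sup>+x. indicator (cball 0 (3 * R)) x * ennreal (norm (grad f x)) \<partial>lebesgue)"
      unfolding G_def by (rule nn_integral_completion[symmetric])
    also have "ennreal m * \<dots> = (\<integral>\<^sup>+x. ennreal m * (indicator (cball 0 (3 * R)) x * ennreal (norm (grad f x))) \<partial>lebesgue)"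
      by (rule nn_integral_cmult[symmetric]) measurable
    also have "\<dots> \<le> (\<integral>\<^sup>+x. ennreal (w x) * ennreal (norm (grad f x)) \<partial>lebesgue)"
      using mM(3) by (intro nn_integral_mono) (auto simp: indicator_def intro!: mult_right_mono ennreal_leI)
    also have "\<dots> = (\<integral>\<^sup>+x. ennreal (norm (grad f x)) \<partial>mu V)"
      unfolding nn_integral_completion by (rule nn_integral_mu[symmetric]) measurable
    also have "\<dots> = ennreal (\<integral>x. norm (grad f x) \<partial>mu V)"
      by (intro nn_integral_eq_integral integrable_norm_grad adm) simp
    finally have e4: "ennreal m * G \<le> ennreal (\<integral>x. norm (grad f x) \<partial>mu V)" .
    define I where "I = (\<integral>x. norm (grad f x) \<partial>mu V)"
    have I0: "0 \<le> I" by (simp add: I_def)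
    have "ennreal (m * (1/4) * (c/2)) = ennreal m * (ennreal (1/4) * ennreal (c/2))"
      using mM assms by (simp add: ennreal_mult[symmetric])
    also have "\<dots> \<le> ennreal m * ((ennreal M * emeasure lborel S) * (ennreal M * a))"
      by (intro mult_left_mono mult_mono e1 e2) auto
    also have "\<dots> = ennreal m * (ennreal M * ennreal M) * (emeasure lborel S * a)"
      by (simp add: mult_ac)
    also have "\<dots> \<le> ennreal m * (ennreal M * ennreal M) * (ennreal k * G)"
      by (intro mult_left_mono e3) auto
    also have "\<dots> = (ennreal M * ennreal M * ennreal k) * (ennreal m * G)" by (simp add: mult_ac)
    also have "\<dots> \<le> (ennreal M * ennreal M * ennreal k) * ennreal I"
      unfolding I_def by (intro mult_left_mono e4) auto
    also have "\<dots> = ennreal (M * M * k * I)"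
      using mM k I0 by (simp add: ennreal_mult)
    finally have "m * (1/4) * (c/2) \<le> M * M * k * I"
      using mM k I0 by (subst (asm) ennreal_le_iff) auto
    also have "\<dots> \<le> M\<^sup>2 * (k + 1) * I"
      unfolding power2_eq_square using mM k I0 by (intro mult_right_mono mult_left_mono) auto
    finally have "m * (1/4) * (c/2) \<le> M\<^sup>2 * (k + 1) * I" .
    moreover have "0 < 8 * (M\<^sup>2 * (k + 1))" using mM k by simp
    ultimately have "s \<le> I"
      unfolding s_def by (subst pos_divide_le_eq) (simp_all add: mult_ac)
    then show ?thesis using energy_ge_square[OF adm, of s] s by (simp add: I_def)
  qed
  show thesis by (rule that[of "s\<^sup>2"]) (use s main in auto)
qed

section \<open>Truncation and the capacity bound\<close>

lemma energy_le_of_dominated: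
  assumes f: "admissible V f" and g: "integrable (mu V) (\<lambda>x. (g x)\<^sup>2)"
    and le: "\<And>x y. \<bar>g y - g x\<bar> \<le> c * \<bar>f y - f x\<bar>" and c: "0 \<le> c"
  shows "admissible V g" "energy V g \<le> c\<^sup>2 * energy V f"
proof -
  have fl: "locally_lipschitz f" and fi: "integrable (mu V) (\<lambda>x. (norm (grad f x))\<^sup>2)"
    using f by (simp_all add: admissible_def)
  have gl: "locally_lipschitz g"
    unfolding locally_lipschitz_def
  proof
    fix x
    obtain e L where e: "e > 0" "L-lipschitz_on (ball x e) f"
      using fl unfolding locally_lipschitz_def by blast
    have "(c * L)-lipschitz_on (ball x e) g"
    proof (rule lipschitz_onI)
      fix y z assume "y \<in> ball x e" "z \<in> ball x e"
      then have "c * \<bar>f y - f z\<bar> \<le> c * (L * dist y z)"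
        using lipschitz_onD[OF e(2)] c by (intro mult_left_mono) (auto simp: dist_real_def)
      then show "dist (g y) (g z) \<le> c * L * dist y z"
        using le[of y z] by (simp add: dist_real_def)
    qed (use c lipschitz_on_nonneg[OF e(2)] in simp)
    then show "\<exists>e>0. \<exists>L. L-lipschitz_on (ball x e) g" using e(1) by blast
  qed
  have [measurable]: "grad g \<in> borel_measurable lebesgue" by (rule borel_measurable_grad[OF gl])
  have ae: "AE x in mu V. (norm (grad g x))\<^sup>2 \<le> c\<^sup>2 * (norm (grad f x))\<^sup>2"
    using AE_mu[OF AE_differentiable_locally_lipschitz[OF fl]]
      AE_mu[OF AE_differentiable_locally_lipschitz[OF gl]]
  proof eventually_elim
    case (elim x)
    then have "norm (grad g x) \<le> c * norm (grad f x)"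
      by (intro norm_grad_le_of_dominated le c)
    then show ?case unfolding power_mult_distrib[symmetric] by (rule power_mono) simp
  qed
  have gi: "integrable (mu V) (\<lambda>x. (norm (grad g x))\<^sup>2)"
    by (rule Bochner_Integration.integrable_bound[of _ "\<lambda>x. c\<^sup>2 * (norm (grad f x))\<^sup>2"])
       (use ae fi in auto)
  show "admissible V g"
    using measurable_locally_lipschitz[OF gl] g gl gi by (simp add: admissible_def cong: measurable_cong_sets)
  have "energy V g \<le> (\<integral>x. c\<^sup>2 * (norm (grad f x))\<^sup>2 \<partial>mu V)"
    unfolding energy_def by (rule integral_mono_AE) (use ae fi gi in auto)
  then show "energy V g \<le> c\<^sup>2 * energy V f" by (simp add: energy_def)
qed

lemma integral_truncation:
  assumes f: "admissible V f" and f01: "\<And>x. 0 \<le> f x \<and> f x \<le> 1" and t: "0 < t" "t < 1"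
    and q: "0 < q" "(\<integral>x. (f x)\<^sup>2 \<partial>mu V) \<le> q * t\<^sup>2"
  defines "g \<equiv> \<lambda>x. max (f x - t) 0 / (1 - t)"
  shows "admissible V g" "energy V g * (1 - t)\<^sup>2 \<le> energy V f"
    "(\<integral>x. \<bar>g x\<bar> \<partial>mu V)\<^sup>2 \<le> q * (\<integral>x. (g x)\<^sup>2 \<partial>mu V)"
proof -
  have fi: "integrable (mu V) (\<lambda>x. (f x)\<^sup>2)" and fl: "locally_lipschitz f"
    using f by (simp_all add: admissible_def)
  have [measurable]: "f \<in> borel_measurable lebesgue" by (rule measurable_locally_lipschitz[OF fl])
  have g01: "0 \<le> g x \<and> g x \<le> 1" for x
    using f01[of x] t by (simp add: g_def max_def)
  have [measurable]: "g \<in> borel_measurable lebesgue" unfolding g_def by measurable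
  have gi: "integrable (mu V) (\<lambda>x. (g x)\<^sup>2)"
    by (rule M.integrable_const_bound[of _ 1]) (use g01 in \<open>auto simp: power_le_one\<close>)
  have gi1: "integrable (mu V) g"
    by (rule M.integrable_const_bound[of _ 1]) (use g01 in auto)
  have le: "\<bar>g y - g x\<bar> \<le> 1 / (1 - t) * \<bar>f y - f x\<bar>" for x y
  proof -
    have "g y - g x = (max (f y - t) 0 - max (f x - t) 0) / (1 - t)"
      by (simp add: g_def diff_divide_distrib)
    moreover have "\<bar>max (f y - t) 0 - max (f x - t) 0\<bar> \<le> \<bar>f y - f x\<bar>" by linarith
    ultimately show ?thesis using t by (simp add: abs_divide divide_right_mono)
  qed
  show "admissible V g" by (rule energy_le_of_dominated[OF f gi le]) (use t in simp)
  have "energy V g \<le> (1 / (1 - t))\<^sup>2 * energy V f"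
    by (rule energy_le_of_dominated[OF f gi le]) (use t in simp)
  then show "energy V g * (1 - t)\<^sup>2 \<le> energy V f"
    using t by (simp add: power_divide pos_le_divide_eq)
  define I where "I = (\<integral>x. g x \<partial>mu V)"
  \<comment> \<open>The optimal multiplier: integrating the pointwise bound \<open>pt\<close> gives
    2 l I \<le> X + l^2 q with X the integral of g^2, and l = I / q turns l^2 q into l I.\<close>
  define l where "l = I / q"
  have I: "0 \<le> I" unfolding I_def by (rule Bochner_Integration.integral_nonneg) (use g01 in simp)
  \<comment> \<open>Cauchy--Schwarz for \<open>g\<close> and the indicator of \<open>{f > t}\<close>, combined with Markov's inequality.\<close>
  have pt: "2 * l * g x \<le> (g x)\<^sup>2 + l\<^sup>2 / t\<^sup>2 * (f x)\<^sup>2" for x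
  proof (cases "f x \<le> t")
    case True
    then show ?thesis by (simp add: g_def)
  next
    case False
    have "1 \<le> (f x)\<^sup>2 / t\<^sup>2" using False t by (simp add: le_divide_eq power_mono)
    then have "l\<^sup>2 * 1 \<le> l\<^sup>2 * ((f x)\<^sup>2 / t\<^sup>2)" by (intro mult_left_mono) auto
    then show ?thesis
      using zero_le_power2[of "g x - l"] by (simp add: power2_diff mult_ac)
  qed
  have "2 * l * I = (\<integral>x. 2 * l * g x \<partial>mu V)" by (simp add: I_def)
  also have "\<dots> \<le> (\<integral>x. (g x)\<^sup>2 + l\<^sup>2 / t\<^sup>2 * (f x)\<^sup>2 \<partial>mu V)"
    by (rule integral_mono) (use gi gi1 fi pt in auto)
  also have "\<dots> = (\<integral>x. (g x)\<^sup>2 \<partial>mu V) + l\<^sup>2 / t\<^sup>2 * (\<integral>x. (f x)\<^sup>2 \<partial>mu V)"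
    using gi fi by simp
  also have "l\<^sup>2 / t\<^sup>2 * (\<integral>x. (f x)\<^sup>2 \<partial>mu V) \<le> l\<^sup>2 / t\<^sup>2 * (q * t\<^sup>2)"
    by (intro mult_left_mono q) auto
  also have "l\<^sup>2 / t\<^sup>2 * (q * t\<^sup>2) = l * I" using t q by (simp add: l_def power2_eq_square)
  finally have "l * I \<le> (\<integral>x. (g x)\<^sup>2 \<partial>mu V)" by (simp add: mult.commute)
  then have "I\<^sup>2 \<le> q * (\<integral>x. (g x)\<^sup>2 \<partial>mu V)"
    using q by (simp add: l_def power2_eq_square pos_divide_le_eq mult.commute)
  then show "(\<integral>x. \<bar>g x\<bar> \<partial>mu V)\<^sup>2 \<le> q * (\<integral>x. (g x)\<^sup>2 \<partial>mu V)"
    using g01 by (simp add: I_def)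
qed

text \<open>Each competitor satisfies one of two bounds, so their minimum survives the infimum. As
  \<open>e\<close> is independent of A, the first entry is the smaller one once mu(A) is small; the
  factor p < 1 is what truncation and absorption cost against 1 / r.\<close>

lemma cap_lower_bound:
  assumes spi: "partial_SPI V r0 \<beta>" and r: "r0 < r" "0 < r" and p: "0 < p" "p < 1"
  obtains e where "0 < e"
    "\<And>A. A \<in> sets (mu V) \<Longrightarrow> ereal (min (p / r * measure (mu V) A) e) \<le> cap V A"
proof -
  \<comment> \<open>Three factors 1 - t are lost, one by absorption and two in the energy of the
    truncation, and (1 - t)^3 \<ge> 1 - 3 t = p.\<close>
  define t where "t = (1 - p) / 3"
  have t: "0 < t" "t < 1" using p by (auto simp: t_def)
  have tp: "p \<le> (1 - t) * (1 - t)\<^sup>2"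
  proof -
    have "(1 - t) * (1 - t)\<^sup>2 = 1 - 3 * t + t\<^sup>2 * (3 - t)" by (simp add: power2_eq_square algebra_simps)
    moreover have "0 \<le> t\<^sup>2 * (3 - t)" using t by (intro mult_nonneg_nonneg) auto
    moreover have "1 - 3 * t = p" by (simp add: t_def field_simps)
    ultimately show ?thesis by linarith
  qed
  \<comment> \<open>The maximum with 1 keeps b a positive divisor whatever the sign of
    \<open>\<beta> r\<close>.\<close>
  define b where "b = max 1 (\<beta> r)"
  have b: "1 \<le> b" "\<beta> r \<le> b" by (auto simp: b_def)
  \<comment> \<open>The threshold for the integral of f^2 is q t^2: below it mu(f > t) \<le> q by
    Markov, and b q = t makes the last term of the super Poincare inequality for the truncation g at
    most t times the integral of g^2.\<close>
  define q where "q = t / b"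
  have q: "0 < q" "b * q = t" using t b by (auto simp: q_def)
  have "0 < q * t\<^sup>2" using q t by simp
  then obtain e where e: "0 < e" "\<And>f. admissible V f \<Longrightarrow> (\<And>x. 0 \<le> f x \<and> f x \<le> 1) \<Longrightarrow>
    measure (mu V) {x. f x \<noteq> 0} \<le> 1/2 \<Longrightarrow> q * t\<^sup>2 \<le> (\<integral>x. (f x)\<^sup>2 \<partial>mu V) \<Longrightarrow> e \<le> energy V f"
    using energy_bounded_below by metis
  have main: "min (p / r * measure (mu V) A) e \<le> energy V f"
    if A: "A \<in> sets (mu V)" and f: "admissible V f" and fA: "\<And>x. indicator A x \<le> f x \<and> f x \<le> 1"
      and half: "measure (mu V) {x. f x \<noteq> 0} \<le> 1/2" for A f
  proof -
    have f01: "0 \<le> f x \<and> f x \<le> 1" for x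
      using fA[of x] by (cases "x \<in> A") auto
    show ?thesis
    proof (cases "q * t\<^sup>2 \<le> (\<integral>x. (f x)\<^sup>2 \<partial>mu V)")
      case True
      then have "e \<le> energy V f" by (intro e(2) f f01 half)
      then show ?thesis by simp
    next
      case False
      then have "(\<integral>x. (f x)\<^sup>2 \<partial>mu V) \<le> q * t\<^sup>2" by simp
      note T = integral_truncation[OF f f01 t q(1) this]
      define g where "g = (\<lambda>x. max (f x - t) 0 / (1 - t))"
      define X where "X = (\<integral>x. (g x)\<^sup>2 \<partial>mu V)"
      have g: "admissible V g" "energy V g * (1 - t)\<^sup>2 \<le> energy V f"
        "(\<integral>x. \<bar>g x\<bar> \<partial>mu V)\<^sup>2 \<le> q * X"
        using T by (simp_all add: g_def X_def)
      have "X \<le> r * energy V g + \<beta> r * (\<integral>x. \<bar>g x\<bar> \<partial>mu V)\<^sup>2"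
        using spi r g(1) by (simp add: partial_SPI_def X_def)
      also have "\<beta> r * (\<integral>x. \<bar>g x\<bar> \<partial>mu V)\<^sup>2 \<le> b * (q * X)"
        using b g(3) by (intro mult_mono) auto
      also have "b * (q * X) = t * X" using q(2) by (simp add: mult.assoc[symmetric])
      finally have "(1 - t) * X \<le> r * energy V g" by (simp add: algebra_simps)
      then have "(1 - t) * X * (1 - t)\<^sup>2 \<le> r * energy V g * (1 - t)\<^sup>2" by (rule mult_right_mono) simp
      also have "\<dots> \<le> r * energy V f" using g(2) r by (simp add: mult.assoc)
      finally have rE: "(1 - t) * (1 - t)\<^sup>2 * X \<le> r * energy V f" by (simp add: mult_ac)
      have AX: "measure (mu V) A \<le> X"
      proof -
        have "measure (mu V) A = (\<integral>x. indicator A x \<partial>mu V)" using A by simp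
        also have "\<dots> \<le> X"
          unfolding X_def
        proof (rule integral_mono)
          show "integrable (mu V) (indicator A :: _ \<Rightarrow> real)"
            using A by (intro integrable_real_indicator) (auto simp: M.emeasure_eq_measure)
          show "integrable (mu V) (\<lambda>x. (g x)\<^sup>2)" using g(1) by (simp add: admissible_def)
          show "indicator A x \<le> (g x)\<^sup>2" for x
            using fA[of x] t by (cases "x \<in> A") (auto simp: g_def)
        qed
        finally show ?thesis .
      qed
      have "p * measure (mu V) A \<le> (1 - t) * (1 - t)\<^sup>2 * X"
        by (rule mult_mono[OF tp AX]) (use t p in auto)
      then have "p / r * measure (mu V) A \<le> energy V f"
        using rE r by (simp add: pos_divide_le_eq mult.commute)
      then show ?thesis by simp
    qed
  qed
  then have "ereal (min (p / r * measure (mu V) A) e) \<le> cap V A" if "A \<in> sets (mu V)" for A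
    unfolding cap_def using that by (intro INF_greatest ereal_less_eq(3)[THEN iffD2] main) auto
  then show thesis using that e(1) by blast
qed

end

section \<open>The choice of the constants\<close>

theorem theorem3p2:
  fixes V :: "real ^ 'n \<Rightarrow> real" and r0 :: real and \<beta> :: "real \<Rightarrow> real"
  assumes "smooth V"
    and "integrable lborel (\<lambda>x. exp (- V x))"
    and "0 \<le> r0"
    and "partial_SPI V r0 \<beta>"
  shows "\<exists>C :: real \<Rightarrow> real.
           (\<forall>\<kappa>. 0 < \<kappa> \<and> \<kappa> \<le> 1/2 \<longrightarrow> C \<kappa> > 0 \<and>
              (\<forall>A \<in> sets (mu V). measure (mu V) A \<le> \<kappa> \<longrightarrow>
                  cap V A \<ge> ereal (C \<kappa> * measure (mu V) A)))
         \<and> Liminf (at_right 0) (\<lambda>\<kappa>. ereal (C \<kappa>)) \<ge> (if r0 = 0 then \<infinity> else ereal (1 / r0))"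
proof -
  have "Ck 0 V" using assms(1) unfolding smooth_def by blast
  then interpret gibbs V using assms(2) by unfold_locales simp_all
  define good where "good \<kappa> M \<longleftrightarrow>
    (\<forall>A \<in> sets (mu V). measure (mu V) A \<le> \<kappa> \<longrightarrow> ereal (M * measure (mu V) A) \<le> cap V A)" for \<kappa> M
  \<comment> \<open>The bound \<open>1 / \<kappa>\<close> keeps the supremum real: it is harmless since \<open>1 / \<kappa>\<close> tends to
    infinity.\<close>
  define S where "S \<kappa> = {M. 0 < M \<and> M \<le> 1 / \<kappa> \<and> good \<kappa> M}" for \<kappa>
  \<comment> \<open>The supremum dominates p / r eventually for every r > r0 and p < 1
    simultaneously, which no fixed choice of r and p would do.\<close>
  define C where "C \<kappa> = Sup (S \<kappa>)" for \<kappa>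
  have bdd: "bdd_above (S \<kappa>)" for \<kappa> by (rule bdd_aboveI[of _ "1 / \<kappa>"]) (simp add: S_def)
  have C_ge: "M \<le> C \<kappa>" if "M \<in> S \<kappa>" for M \<kappa>
    unfolding C_def by (rule cSup_upper[OF that bdd])
  have ne: "\<exists>M. M \<in> S \<kappa>" if \<kappa>: "0 < \<kappa>" "\<kappa> \<le> 1/2" for \<kappa>
  proof -
    have r: "r0 < r0 + 1" "0 < r0 + 1" using assms(3) by auto
    obtain e where e: "0 < e" "\<And>A. A \<in> sets (mu V) \<Longrightarrow>
        ereal (min ((1/2) / (r0 + 1) * measure (mu V) A) e) \<le> cap V A"
      using cap_lower_bound[OF assms(4) r, of "1/2"] by auto
    \<comment> \<open>Since mu(A) \<le> 1, the entry e takes care of the second term of the minimum;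
      the entry 1 ensures M \<le> 1 / kappa.\<close>
    define M where "M = min (min ((1/2) / (r0 + 1)) e) 1"
    have M: "0 < M" "M \<le> 1" "M \<le> (1/2) / (r0 + 1)" "M \<le> e" using e(1) r by (auto simp: M_def)
    have "M * measure (mu V) A \<le> min ((1/2) / (r0 + 1) * measure (mu V) A) e" for A
    proof (rule min.boundedI)
      show "M * measure (mu V) A \<le> (1/2) / (r0 + 1) * measure (mu V) A"
        by (intro mult_right_mono M) simp
      have "M * measure (mu V) A \<le> M * 1"
        using M by (intro mult_left_mono measure_mu_le_1) auto
      then show "M * measure (mu V) A \<le> e" using M by linarith
    qed
    then have "good \<kappa> M" unfolding good_def using e(2) by (meson ereal_less_eq(3) order_trans)
    moreover have "M \<le> 1 / \<kappa>" using M \<kappa> by (intro order_trans[OF M(2)]) simp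
    ultimately show ?thesis using M by (auto simp: S_def)
  qed
  have C_pos: "0 < C \<kappa>" if \<kappa>: "0 < \<kappa>" "\<kappa> \<le> 1/2" for \<kappa>
  proof -
    obtain M where M: "M \<in> S \<kappa>" using ne[OF \<kappa>] by blast
    then have "0 < M" by (simp add: S_def)
    then show ?thesis using C_ge[OF M] by simp
  qed
  have C_good: "ereal (C \<kappa> * measure (mu V) A) \<le> cap V A"
    if \<kappa>: "0 < \<kappa>" "\<kappa> \<le> 1/2" and A: "A \<in> sets (mu V)" "measure (mu V) A \<le> \<kappa>" for \<kappa> A
  proof -
    obtain M0 where M0: "M0 \<in> S \<kappa>" using ne[OF \<kappa>] by blast
    have *: "ereal (M * measure (mu V) A) \<le> cap V A" if "M \<in> S \<kappa>" for M
      using that A by (simp add: S_def good_def)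
    show ?thesis
    \<comment> \<open>The inequality is closed in M, so it passes to the supremum: for finite
      capacity and mu(A) > 0 it says M \<le> c / mu(A).\<close>
    proof (cases "cap V A")
      case (real c)
      show ?thesis
      proof (cases "measure (mu V) A = 0")
        case True
        then show ?thesis using *[OF M0] by simp
      next
        case False
        then have pos: "0 < measure (mu V) A" by (simp add: zero_less_measure_iff)
        have "C \<kappa> \<le> c / measure (mu V) A"
          unfolding C_def
        proof (rule cSup_least)
          show "S \<kappa> \<noteq> {}" using M0 by auto
          show "M \<le> c / measure (mu V) A" if "M \<in> S \<kappa>" for M
            using *[OF that] pos real by (simp add: pos_le_divide_eq)
        qed
        then show ?thesis using pos real by (simp add: pos_le_divide_eq)
      qed
    next
      case MInf
      then show ?thesis using *[OF M0] by simp
    qed simp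
  qed
  have C_ev: "\<forall>\<^sub>F \<kappa> in at_right 0. p / r \<le> C \<kappa>" if r: "r0 < r" and p: "0 < p" "p < 1" for r p
  proof -
    have r': "0 < r" using r assms(3) by simp
    obtain e where e: "0 < e" "\<And>A. A \<in> sets (mu V) \<Longrightarrow>
        ereal (min (p / r * measure (mu V) A) e) \<le> cap V A"
      using cap_lower_bound[OF assms(4) r r' p] by metis
    \<comment> \<open>For kappa below e r / p the first entry of the minimum is at most e; below r /
      p the constant p / r respects the bound 1 / kappa in \<open>S\<close>.\<close>
    have "0 < e * r / p" "0 < r / p" using e(1) r' p by auto
    then have "\<forall>\<^sub>F \<kappa> in at_right 0. \<kappa> < e * r / p" "\<forall>\<^sub>F \<kappa> in at_right 0. \<kappa> < r / p" "\<forall>\<^sub>F \<kappa>::real in at_right 0. 0 < \<kappa>"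
      by (auto simp: eventually_at_right_field)
    then show ?thesis
    proof eventually_elim
      case (elim \<kappa>)
      have "good \<kappa> (p / r)"
        unfolding good_def
      proof (intro ballI impI)
        fix A assume A: "A \<in> sets (mu V)" "measure (mu V) A \<le> \<kappa>"
        have "p / r * measure (mu V) A \<le> p / r * \<kappa>" using A r' p by (intro mult_left_mono) auto
        also have "\<dots> \<le> e" using elim(1) r' p by (simp add: field_simps)
        finally show "ereal (p / r * measure (mu V) A) \<le> cap V A" using e(2)[OF A(1)] by (simp add: min_def)
      qed
      moreover have "p / r \<le> 1 / \<kappa>" using elim r' p by (simp add: field_simps)
      ultimately show ?case using r' p by (intro C_ge) (simp add: S_def)
    qed
  qed
  have "(if r0 = 0 then \<infinity> else ereal (1 / r0)) \<le> Liminf (at_right 0) (\<lambda>\<kappa>. ereal (C \<kappa>))"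
    unfolding le_Liminf_iff
  proof (intro allI impI)
    fix y assume y: "y < (if r0 = 0 then \<infinity> else ereal (1 / r0))"
    have "\<exists>r p. r0 < r \<and> 0 < p \<and> p < 1 \<and> y < ereal (p / r)"
    proof (cases "r0 = 0")
      case True
      then obtain b where b: "y \<le> ereal b" using y by (cases y) auto
      \<comment> \<open>Here p = 1/2 and r = 1 / (2 (|b| + 1)), so that p / r = |b| + 1.\<close>
      have "b < (1/2) / (1 / (2 * (\<bar>b\<bar> + 1)))" by simp
      then have "y < ereal ((1/2) / (1 / (2 * (\<bar>b\<bar> + 1))))" using b by (meson ereal_less_eq(3) less_ereal.simps(1) order_le_less_trans)
      then show ?thesis using True
        by (intro exI[of _ "1 / (2 * (\<bar>b\<bar> + 1))"] exI[of _ "1/2"]) (simp add: field_simps)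
    next
      case False
      \<comment> \<open>Here p = 1 - \<delta> and r = r0 + \<delta>, so that p / r tends to 1 /
        r0.\<close>
      have "((\<lambda>\<delta>. ereal ((1 - \<delta>) / (r0 + \<delta>))) \<longlongrightarrow> ereal ((1 - 0) / (r0 + 0))) (at_right 0)"
        using False by (intro tendsto_intros) simp
      then have "\<forall>\<^sub>F \<delta> in at_right 0. y < ereal ((1 - \<delta>) / (r0 + \<delta>))"
        using y False by (intro order_tendstoD) auto
      moreover have "\<forall>\<^sub>F \<delta>::real in at_right 0. 0 < \<delta> \<and> \<delta> < 1"
        by (auto simp: eventually_at_right_field intro: exI[of _ 1])
      ultimately have "\<forall>\<^sub>F \<delta> in at_right 0. (0 < \<delta> \<and> \<delta> < 1) \<and> y < ereal ((1 - \<delta>) / (r0 + \<delta>))"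
        by eventually_elim simp
      then obtain \<delta> where "0 < \<delta>" "\<delta> < 1" "y < ereal ((1 - \<delta>) / (r0 + \<delta>))"
        using eventually_happens'[OF trivial_limit_at_right_real] by blast
      then show ?thesis by (intro exI[of _ "r0 + \<delta>"] exI[of _ "1 - \<delta>"]) auto
    qed
    then obtain r p where rp: "r0 < r" "0 < p" "p < 1" "y < ereal (p / r)" by blast
    from C_ev[OF rp(1-3)] show "\<forall>\<^sub>F \<kappa> in at_right 0. y < ereal (C \<kappa>)"
      by eventually_elim (use rp(4) in \<open>meson ereal_less_eq(3) order_less_le_trans\<close>)
  qed
  then show ?thesis using C_pos C_good by (intro exI[of _ C]) blast
qed

end
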